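(* Let $G\cong(\mathbb{Z}/p\mathbb{Z})^n$ with $n\ge1$. If $G\not\cong(\mathbb{Z}/2\mathbb{Z})^2$ and $G\not\cong(\mathbb{Z}/2\mathbb{Z})^4$, then $\tau(G)=n+1$; if $G\cong(\mathbb{Z}/2\mathbb{Z})^2$ or $(\mathbb{Z}/2\mathbb{Z})^4$, then $\tau(G)=n$.
   Context: A projective representation of $G$ is an $\alpha$-representation for some cocycle $\alpha\in Z^2(G,\mathbb{C}^\times)$: a map $\rho:G\to\mathrm{GL}_m(\mathbb{C})$ with $\rho(1)=I$ and $\rho(g)\rho(h)=\alpha(g,h)\rho(gh)$; it is faithful if the only $g$ with $\rho(g)$ scalar is $g=1$. $\tau(G)$ is the least degree of a faithful projective representation of $G$. *)

theory Defs
  imports "HOL-Algebra.Product_Groups" "HOL-Algebra.Elementary_Groups" "Jordan_Normal_Form.Matrix"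
begin

definition elem_ab :: "nat \<Rightarrow> nat \<Rightarrow> (nat \<Rightarrow> int) monoid" where
  "elem_ab p n = product_group {..<n} (\<lambda>_. integer_mod_group p)"

definition cocycle2 :: "('g, 'b) monoid_scheme \<Rightarrow> ('g \<Rightarrow> 'g \<Rightarrow> complex) \<Rightarrow> bool" where
  "cocycle2 G \<alpha> \<longleftrightarrow>
     (\<forall>g\<in>carrier G. \<forall>h\<in>carrier G. \<alpha> g h \<noteq> 0) \<and>
     (\<forall>g\<in>carrier G. \<forall>h\<in>carrier G. \<forall>k\<in>carrier G.
        \<alpha> g h * \<alpha> (g \<otimes>\<^bsub>G\<^esub> h) k = \<alpha> h k * \<alpha> g (h \<otimes>\<^bsub>G\<^esub> k))"

definition alpha_rep ::
  "('g, 'b) monoid_scheme \<Rightarrow> ('g \<Rightarrow> 'g \<Rightarrow> complex) \<Rightarrow> nat \<Rightarrow> ('g \<Rightarrow> complex mat) \<Rightarrow> bool" where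
  "alpha_rep G \<alpha> m \<rho> \<longleftrightarrow>
     (\<forall>g\<in>carrier G. \<rho> g \<in> carrier_mat m m \<and> invertible_mat (\<rho> g)) \<and>
     \<rho> \<one>\<^bsub>G\<^esub> = 1\<^sub>m m \<and>
     (\<forall>g\<in>carrier G. \<forall>h\<in>carrier G. \<rho> g * \<rho> h = \<alpha> g h \<cdot>\<^sub>m \<rho> (g \<otimes>\<^bsub>G\<^esub> h))"

definition faithful_proj_rep ::
  "('g, 'b) monoid_scheme \<Rightarrow> nat \<Rightarrow> ('g \<Rightarrow> complex mat) \<Rightarrow> bool" where
  "faithful_proj_rep G m \<rho> \<longleftrightarrow>
     (\<exists>\<alpha>. cocycle2 G \<alpha> \<and> alpha_rep G \<alpha> m \<rho>) \<and>
     (\<forall>g\<in>carrier G. (\<exists>c. \<rho> g = c \<cdot>\<^sub>m 1\<^sub>m m) \<longrightarrow> g = \<one>\<^bsub>G\<^esub>)"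

definition tau :: "('g, 'b) monoid_scheme \<Rightarrow> nat" where
  "tau G = (LEAST m. \<exists>\<rho>. faithful_proj_rep G m \<rho>)"

end

theory Submission
  imports Defs "Jordan_Normal_Form.VS_Connect" "Jordan_Normal_Form.Determinant"
    "HOL-Computational_Algebra.Primes"
begin

text \<open>Let \<open>\<rho>\<close> be a faithful projective representation of degree \<open>m\<close> of \<open>G = (\<int>/p)\<^sup>n\<close> with cocycle
  \<open>\<alpha>\<close>. The function \<open>\<alpha> g h / \<alpha> h g\<close> is an alternating bicharacter of \<open>G\<close>; let \<open>A\<close> be a maximal
  isotropic subgroup, of index \<open>p\<^sup>k\<close>. The commuting matrices \<open>\<rho>(A)\<close> are simultaneously
  diagonalizable, so they have at most \<open>m\<close> joint weights, and \<open>\<rho>(g)\<close> multiplies a weight by the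
  character \<open>\<alpha> a g / \<alpha> g a\<close> of \<open>A\<close>; since \<open>A\<close> is its own orthogonal complement, \<open>G/A\<close> acts freely and
  \<open>m \<ge> c p\<^sup>k\<close>, with \<open>c \<ge> 1\<close> the number of orbits. An element of \<open>A\<close> at which all weights agree acts as a
  scalar, so the \<open>c - 1\<close> ratios of orbit representatives and \<open>k\<close> characters coming from
  generators of \<open>G/A\<close> separate the points of \<open>A\<close>, whence \<open>n - k \<le> k + c - 1\<close>. Now
  \<open>c p\<^sup>k \<ge> 2 k + c \<ge> n + 1\<close> unless \<open>p = 2\<close>, \<open>c = 1\<close> and \<open>k \<in> {1, 2}\<close>, where \<open>m \<ge> 2 k \<ge> n\<close>.
  These bounds are attained by the diagonal representation \<open>1 \<oplus> \<chi>\<^sub>1 \<oplus> \<dots> \<oplus> \<chi>\<^sub>n\<close>, by the Pauli matrices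
  and by their tensor square.\<close>

subsection \<open>Joint eigenvectors of a commuting family\<close>

text \<open>If \<zeta>^p = \<kappa>, then T - \<zeta> kills the sum of \<zeta>^(p-1-i) T^i v over i
  < p, because T^p v = \<zeta>^p v. Were this sum zero for all p roots \<zeta>, each of its
  coordinates, a polynomial in \<zeta> of degree below p, would vanish identically, and with it the
  coefficient of \<zeta>^(p-1), a coordinate of v.\<close>

lemma exists_eigenvector_in_invariant_subspace:
  fixes T :: "complex mat" and \<kappa> :: complex
  assumes T: "T \<in> carrier_mat m m" and W: "W \<subseteq> carrier_vec m"
    and add: "\<And>u w. u \<in> W \<Longrightarrow> w \<in> W \<Longrightarrow> u + w \<in> W"
    and smult: "\<And>z u. u \<in> W \<Longrightarrow> z \<cdot>\<^sub>v u \<in> W"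
    and inv: "\<And>u. u \<in> W \<Longrightarrow> T *\<^sub>v u \<in> W"
    and v: "v \<in> W" "v \<noteq> 0\<^sub>v m"
    and p: "p > 0" and \<kappa>: "\<kappa> \<noteq> 0" and pow: "((*\<^sub>v) T ^^ p) v = \<kappa> \<cdot>\<^sub>v v"
  obtains u z where "u \<in> W" "u \<noteq> 0\<^sub>v m" "T *\<^sub>v u = z \<cdot>\<^sub>v u"
proof -
  define t where "t k = ((*\<^sub>v) T ^^ k) v" for k
  \<comment> \<open>Horner form of the sum of \<zeta>^(k-i) T^i v over i \<le> k, which matches
    \<open>pCons\<close> coordinate by coordinate.\<close>
  define h where "h \<zeta> = rec_nat v (\<lambda>k u. \<zeta> \<cdot>\<^sub>v u + t (Suc k))" for \<zeta>
  have h0: "h \<zeta> 0 = v" and hS: "h \<zeta> (Suc k) = \<zeta> \<cdot>\<^sub>v h \<zeta> k + t (Suc k)" for \<zeta> k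
    by (simp_all add: h_def)
  have tW: "t k \<in> W" for k
    by (induction k) (use v inv in \<open>auto simp: t_def\<close>)
  have hW: "h \<zeta> k \<in> W" for \<zeta> k
    by (induction k) (use v add smult tW in \<open>auto simp: h0 hS\<close>)
  have tC: "t k \<in> carrier_vec m" and hC: "h \<zeta> k \<in> carrier_vec m" for \<zeta> k
    using tW hW W by blast+
  have vC: "v \<in> carrier_vec m" using v W by blast
  \<comment> \<open>Telescoping sum. For k = p - 1 the last two terms cancel, as t p = \<kappa> v =
    \<zeta>^p v.\<close>
  have Th: "T *\<^sub>v h \<zeta> k = \<zeta> \<cdot>\<^sub>v h \<zeta> k + t (Suc k) - \<zeta> ^ Suc k \<cdot>\<^sub>v v" for \<zeta> k
  proof (induction k)
    case 0
    have "t (Suc 0) = T *\<^sub>v v" by (simp add: t_def)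
    then show ?case using vC T by (intro eq_vecI) (auto simp: h0)
  next
    case (Suc k)
    have t2: "t (Suc (Suc k)) = T *\<^sub>v t (Suc k)" by (simp add: t_def)
    have "T *\<^sub>v h \<zeta> (Suc k) = \<zeta> \<cdot>\<^sub>v (T *\<^sub>v h \<zeta> k) + t (Suc (Suc k))"
      unfolding hS t2 using T hC tC
      by (simp add: mult_add_distrib_mat_vec[of _ m m] mult_mat_vec[of _ m m])
    also have "\<dots> = \<zeta> \<cdot>\<^sub>v h \<zeta> (Suc k) + t (Suc (Suc k)) - \<zeta> ^ Suc (Suc k) \<cdot>\<^sub>v v"
      unfolding Suc.IH hS using hC[of \<zeta> k] tC[of "Suc k"] tC[of "Suc (Suc k)"] vC
      by (intro eq_vecI) (auto simp: algebra_simps)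
    finally show ?case .
  qed
  have "\<exists>\<zeta>. \<zeta> ^ p = \<kappa> \<and> h \<zeta> (p - 1) \<noteq> 0\<^sub>v m"
  proof (rule ccontr)
    assume "\<not> ?thesis"
    then have zero: "h \<zeta> (p - 1) = 0\<^sub>v m" if "\<zeta> ^ p = \<kappa>" for \<zeta> using that by auto
    have "v $ i = 0" if i: "i < m" for i
    proof -
      define q where "q = rec_nat [:v $ i:] (\<lambda>k r. pCons (t (Suc k) $ i) r)"
      have q0: "q 0 = [:v $ i:]" and qS: "q (Suc k) = pCons (t (Suc k) $ i) (q k)" for k
        by (simp_all add: q_def)
      have poly: "poly (q k) \<zeta> = h \<zeta> k $ i" for k \<zeta>
        by (induction k) (use carrier_vecD[OF hC] carrier_vecD[OF tC] i in \<open>auto simp: q0 qS h0 hS\<close>)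
      have deg: "degree (q k) \<le> k" for k
        by (induction k) (auto simp: q0 qS degree_pCons_le intro: order_trans)
      have lead: "coeff (q k) k = v $ i" for k
        by (induction k) (auto simp: q0 qS)
      have "q (p - 1) = 0"
      proof (rule ccontr)
        assume nz: "q (p - 1) \<noteq> 0"
        have "{\<zeta>. \<zeta> ^ p = \<kappa>} \<subseteq> {\<zeta>. poly (q (p - 1)) \<zeta> = 0}"
          using zero i by (auto simp: poly)
        then have "card {\<zeta>. \<zeta> ^ p = \<kappa>} \<le> card {\<zeta>. poly (q (p - 1)) \<zeta> = 0}"
          by (intro card_mono poly_roots_finite nz)
        also have "\<dots> \<le> p - 1" using card_poly_roots_bound[OF nz] deg[of "p - 1"] by linarith
        finally show False using card_nth_roots[OF \<kappa> p] p by simp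
      qed
      then show ?thesis using lead[of "p - 1"] by simp
    qed
    then have "v = 0\<^sub>v m" using vC by (intro eq_vecI) auto
    with v show False by simp
  qed
  then obtain \<zeta> where \<zeta>: "\<zeta> ^ p = \<kappa>" "h \<zeta> (p - 1) \<noteq> 0\<^sub>v m" by blast
  have "T *\<^sub>v h \<zeta> (p - 1) = \<zeta> \<cdot>\<^sub>v h \<zeta> (p - 1)"
    using Th[of \<zeta> "p - 1"] p \<zeta> pow hC[of \<zeta> "p - 1"] vC
    by (simp add: t_def del: funpow.simps) (intro eq_vecI, auto)
  with \<zeta>(2) hW that show thesis by blast
qed

text \<open>\<open>pow\<close> says that T a ^ p is the nonzero scalar \<kappa> a, so T a is a root
  of the separable polynomial X^p - \<kappa> a; this is the form in which diagonalizability
  enters.\<close>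

locale commuting_family =
  fixes T :: "'i \<Rightarrow> complex mat" and A :: "'i set" and m p :: nat and \<kappa> :: "'i \<Rightarrow> complex"
  assumes T: "\<And>a. a \<in> A \<Longrightarrow> T a \<in> carrier_mat m m"
    and commute: "\<And>a b. a \<in> A \<Longrightarrow> b \<in> A \<Longrightarrow> T a * T b = T b * T a"
    and finite_index: "finite A"
    and p_pos: "p > 0"
    and \<kappa>: "\<And>a. a \<in> A \<Longrightarrow> \<kappa> a \<noteq> 0"
    and pow: "\<And>a v. a \<in> A \<Longrightarrow> v \<in> carrier_vec m \<Longrightarrow> ((*\<^sub>v) (T a) ^^ p) v = \<kappa> a \<cdot>\<^sub>v v"
begin

definition joint_eigenvector :: "('i \<Rightarrow> complex) \<Rightarrow> complex vec \<Rightarrow> bool" where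
  "joint_eigenvector w v \<longleftrightarrow>
     v \<in> carrier_vec m \<and> v \<noteq> 0\<^sub>v m \<and> (\<forall>a\<in>A. T a *\<^sub>v v = w a \<cdot>\<^sub>v v)"

lemma commute_vec:
  "a \<in> A \<Longrightarrow> b \<in> A \<Longrightarrow> v \<in> carrier_vec m \<Longrightarrow> T a *\<^sub>v (T b *\<^sub>v v) = T b *\<^sub>v (T a *\<^sub>v v)"
  by (metis T assoc_mult_mat_vec commute)

text \<open>The eigenspace of one member within W is invariant under the others, since the family
  commutes; the search continues inside it, one index at a time.\<close>

lemma exists_joint_eigenvector:
  assumes W: "W \<subseteq> carrier_vec m"
    and add: "\<And>u w. u \<in> W \<Longrightarrow> w \<in> W \<Longrightarrow> u + w \<in> W"
    and smult: "\<And>z u. u \<in> W \<Longrightarrow> z \<cdot>\<^sub>v u \<in> W"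
    and inv: "\<And>a u. a \<in> A \<Longrightarrow> u \<in> W \<Longrightarrow> T a *\<^sub>v u \<in> W"
    and v: "v \<in> W" "v \<noteq> 0\<^sub>v m"
  obtains u w where "u \<in> W" "joint_eigenvector w u"
proof -
  have "\<exists>u\<in>W. u \<noteq> 0\<^sub>v m \<and> (\<forall>b\<in>B. \<exists>z. T b *\<^sub>v u = z \<cdot>\<^sub>v u)" if "B \<subseteq> A" for B
    using finite_subset[OF that finite_index] that W add smult inv v
  proof (induction B arbitrary: W v rule: finite_induct)
    case empty
    then show ?case by auto
  next
    case (insert b B)
    then have b: "b \<in> A" and WC: "u \<in> W \<Longrightarrow> u \<in> carrier_vec m" for u by auto
    obtain u z where u: "u \<in> W" "u \<noteq> 0\<^sub>v m" "T b *\<^sub>v u = z \<cdot>\<^sub>v u"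
      using exists_eigenvector_in_invariant_subspace[OF T[OF b] insert.prems(2-4)
          insert.prems(5)[OF b] insert.prems(6,7) p_pos \<kappa>[OF b] pow[OF b WC[OF insert.prems(6)]]]
      by blast
    define W' where "W' = {x \<in> W. T b *\<^sub>v x = z \<cdot>\<^sub>v x}"
    have "\<exists>u\<in>W'. u \<noteq> 0\<^sub>v m \<and> (\<forall>b\<in>B. \<exists>z. T b *\<^sub>v u = z \<cdot>\<^sub>v u)"
    proof (rule insert.IH)
      show "B \<subseteq> A" using insert.prems by auto
      show "W' \<subseteq> carrier_vec m" using WC by (auto simp: W'_def)
      show "x + y \<in> W'" if "x \<in> W'" "y \<in> W'" for x y
        using that insert.prems(3) WC T[OF b]
        by (auto simp: W'_def mult_add_distrib_mat_vec[of _ m m] smult_add_distrib_vec[of _ m])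
      show "y \<cdot>\<^sub>v x \<in> W'" if "x \<in> W'" for x y
        using that insert.prems(4) WC T[OF b]
        by (auto simp: W'_def mult_mat_vec[of _ m m] smult_smult_assoc mult.commute)
      show "T a *\<^sub>v x \<in> W'" if "a \<in> A" "x \<in> W'" for a x
        using that insert.prems(5) WC T commute_vec[OF b \<open>a \<in> A\<close>]
        by (auto simp: W'_def mult_mat_vec[of _ m m])
      show "u \<in> W'" "u \<noteq> 0\<^sub>v m" using u by (auto simp: W'_def)
    qed
    then show ?case by (auto simp: W'_def)
  qed
  from this[OF order_refl] obtain u where u: "u \<in> W" "u \<noteq> 0\<^sub>v m" "\<forall>a\<in>A. \<exists>z. T a *\<^sub>v u = z \<cdot>\<^sub>v u"
    by blast
  from u(3) obtain w where "\<forall>a\<in>A. T a *\<^sub>v u = w a \<cdot>\<^sub>v u" by metis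
  with u W that show thesis unfolding joint_eigenvector_def by blast
qed

lemma funpow_eigenvector:
  fixes M :: "complex mat"
  assumes "M \<in> carrier_mat m m" "u \<in> carrier_vec m" "M *\<^sub>v u = c \<cdot>\<^sub>v u"
  shows "((*\<^sub>v) M ^^ k) u = c ^ k \<cdot>\<^sub>v u"
proof (induction k)
  case (Suc k)
  then show ?case
    using mult_mat_vec[OF assms(1,2), of "c ^ k"] assms(3) by (simp add: smult_smult_assoc mult.commute)
qed (simp add: one_smult_vec)

text \<open>If the weights at \<open>x\<close> did not see that \<open>T x\<close> is non-scalar, the image of \<open>T x - c\<close> would contain
  a joint eigenvector, i.e. \<open>T x\<close> would have a Jordan block of size at least 2; but \<open>T x\<close> is
  diagonalizable, because \<open>T x ^ p\<close> is a nonzero scalar.\<close>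

lemma scalar_of_constant_weight:
  assumes x: "x \<in> A" and c: "\<And>w v. joint_eigenvector w v \<Longrightarrow> w x = c"
  shows "T x = c \<cdot>\<^sub>m 1\<^sub>m m"
proof -
  note Tx = T[OF x]
  have "T x *\<^sub>v v = c \<cdot>\<^sub>v v" if vC: "v \<in> carrier_vec m" for v
  proof (rule ccontr)
    assume ne: "T x *\<^sub>v v \<noteq> c \<cdot>\<^sub>v v"
    define N where "N v = T x *\<^sub>v v - c \<cdot>\<^sub>v v" for v
    \<comment> \<open>The image of T x - c is an invariant subspace and, by assumption, nonzero, so
      it contains a joint eigenvector.\<close>
    define W where "W = N ` carrier_vec m"
    have NC: "N v \<in> carrier_vec m" if "v \<in> carrier_vec m" for v
      using that Tx by (auto simp: N_def)
    have WC: "W \<subseteq> carrier_vec m" using NC by (auto simp: W_def)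
    have "N v \<noteq> 0\<^sub>v m"
    proof
      assume 0: "N v = 0\<^sub>v m"
      have "T x *\<^sub>v v = N v + c \<cdot>\<^sub>v v" using Tx vC by (intro eq_vecI) (auto simp: N_def)
      with 0 ne vC show False by simp
    qed
    moreover have "u + w \<in> W" if "u \<in> W" "w \<in> W" for u w
    proof -
      from that obtain u' w' where "u' \<in> carrier_vec m" "w' \<in> carrier_vec m" "u = N u'" "w = N w'"
        by (auto simp: W_def)
      moreover from this have "N u' + N w' = N (u' + w')"
        using Tx unfolding N_def by (simp add: mult_add_distrib_mat_vec[of _ m m])
          (intro eq_vecI, auto simp: algebra_simps)
      ultimately show ?thesis by (auto simp: W_def)
    qed
    moreover have "z \<cdot>\<^sub>v u \<in> W" if "u \<in> W" for z u
    proof -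
      from that obtain u' where "u' \<in> carrier_vec m" "u = N u'" by (auto simp: W_def)
      moreover from this have "z \<cdot>\<^sub>v N u' = N (z \<cdot>\<^sub>v u')"
        using Tx unfolding N_def by (simp add: mult_mat_vec[of _ m m])
          (intro eq_vecI, auto simp: algebra_simps)
      ultimately show ?thesis by (auto simp: W_def)
    qed
    moreover have "T a *\<^sub>v u \<in> W" if a: "a \<in> A" and "u \<in> W" for a u
    proof -
      from that obtain u' where u': "u' \<in> carrier_vec m" "u = N u'" by (auto simp: W_def)
      then have "T a *\<^sub>v N u' = N (T a *\<^sub>v u')"
        using Tx T[OF a] commute_vec[OF x a]
        unfolding N_def by (simp add: mult_minus_distrib_mat_vec[of _ m m] mult_mat_vec[of _ m m])
      with u' T[OF a] show ?thesis by (auto simp: W_def)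
    qed
    ultimately obtain u w where uW: "u \<in> W" and u: "joint_eigenvector w u"
      using exists_joint_eigenvector[OF WC, of "N v"] vC by (metis W_def imageI)
    from uW obtain v' where v': "v' \<in> carrier_vec m" "u = N v'" by (auto simp: W_def)
    from u have uC: "u \<in> carrier_vec m" "u \<noteq> 0\<^sub>v m" and Tu: "T x *\<^sub>v u = c \<cdot>\<^sub>v u"
      using x c[OF u] by (auto simp: joint_eigenvector_def)
    \<comment> \<open>On v' and u, T x acts as a Jordan block of size 2 with eigenvalue c.\<close>
    have Tv: "T x *\<^sub>v v' = c \<cdot>\<^sub>v v' + u" using v' Tx by (intro eq_vecI) (auto simp: N_def)
    \<comment> \<open>Powers of the block. For k = 0 the truncated exponent k - 1 is harmless, its
      factor being 0.\<close>
    have pow_v: "((*\<^sub>v) (T x) ^^ k) v' = c ^ k \<cdot>\<^sub>v v' + (of_nat k * c ^ (k - 1)) \<cdot>\<^sub>v u" for k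
    proof (induction k)
      case 0
      show ?case using v' uC by (intro eq_vecI) auto
    next
      case (Suc k)
      have "c * (of_nat k * c ^ (k - 1)) = of_nat k * c ^ k" by (cases k) auto
      then show ?case using Suc v' uC Tx Tu Tv
        by (simp add: mult_add_distrib_mat_vec[of _ m m] mult_mat_vec[of _ m m])
           (intro eq_vecI, auto simp: algebra_simps)
    qed
    have "i < m \<Longrightarrow> c ^ p * u $ i = \<kappa> x * u $ i" for i
      using funpow_eigenvector[OF Tx uC(1) Tu, of p] pow[OF x uC(1)] uC
      by (metis carrier_vecD index_smult_vec(1))
    moreover obtain i where i: "i < m" "u $ i \<noteq> 0" using uC by (metis eq_vecI carrier_vecD index_zero_vec)
    ultimately have cp: "c ^ p = \<kappa> x" by auto
    then have "c \<noteq> 0" by (metis \<kappa> x p_pos zero_power)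
    \<comment> \<open>Since T x ^ p also multiplies v' by c^p, the term p c^(p-1) u must vanish,
      which is impossible in characteristic 0.\<close>
    have "(c ^ p \<cdot>\<^sub>v v' + (of_nat p * c ^ (p - 1)) \<cdot>\<^sub>v u) $ i = (\<kappa> x \<cdot>\<^sub>v v') $ i"
      using pow_v[of p] pow[OF x v'(1)] by simp
    then have "of_nat p * c ^ (p - 1) * u $ i = 0" using i uC v' cp by auto
    with i p_pos \<open>c \<noteq> 0\<close> show False by auto
  qed
  note eigen = this
  show ?thesis
  proof (rule eq_matI)
    fix i j assume "i < dim_row (c \<cdot>\<^sub>m 1\<^sub>m m)" "j < dim_col (c \<cdot>\<^sub>m 1\<^sub>m m)"
    then have ij: "i < m" "j < m" by auto
    have "T x $$ (i, j) = (T x *\<^sub>v unit_vec m j) $ i" using ij Tx by auto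
    also have "\<dots> = (c \<cdot>\<^sub>m 1\<^sub>m m) $$ (i, j)" using ij by (auto simp: eigen unit_vec_def)
    finally show "T x $$ (i, j) = (c \<cdot>\<^sub>m 1\<^sub>m m) $$ (i, j)" .
  qed (use Tx in auto)
qed

text \<open>Joint eigenvectors with distinct weights are linearly independent.
  \<open>extensional\<close> identifies weights that agree on A, so that distinct ones differ at
  some a in A.\<close>

lemma card_weights_le:
  assumes "finite Y" and Y: "\<And>w. w \<in> Y \<Longrightarrow> \<exists>v. joint_eigenvector w v" and ext: "Y \<subseteq> extensional A"
  shows "card Y \<le> m"
proof -
  interpret vec_space "TYPE(complex)" m .
  obtain e where e: "joint_eigenvector w (e w)" if "w \<in> Y" for w using Y by metis
  have eC: "e w \<in> carrier_vec m" "e w \<noteq> 0\<^sub>v m" if "w \<in> Y" for w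
    using e[OF that] by (auto simp: joint_eigenvector_def)
  have e_eig: "(T a *\<^sub>v e w) $ i = w a * e w $ i" if "w \<in> Y" "a \<in> A" "i < m" for w a i
    using e[OF that(1)] that by (auto simp: joint_eigenvector_def)
  have diff: "\<exists>a\<in>A. w a \<noteq> w' a" if "w \<in> Y" "w' \<in> Y" "w \<noteq> w'" for w w'
    using that ext by (metis extensionalityI subsetD)
  have indep: "\<forall>w\<in>Z. b w = 0" if "Z \<subseteq> Y" "\<And>i. i < m \<Longrightarrow> (\<Sum>w\<in>Z. b w * e w $ i) = 0" for Z b
    using finite_subset[OF that(1) \<open>finite Y\<close>] that
  proof (induction Z arbitrary: b rule: finite_induct)
    case empty
    then show ?case by simp
  next
    case (insert w0 Z)
    \<comment> \<open>Applying T a - w0 a to the relation removes the term of w0 and scales the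
      others by w a - w0 a.\<close>
    have IH: "\<forall>w\<in>Z. b w * (w a - w0 a) = 0" if a: "a \<in> A" for a
    proof (rule insert.IH)
      show "Z \<subseteq> Y" using insert.prems by auto
      fix i assume i: "i < m"
      have Te: "(\<Sum>j<m. T a $$ (i, j) * e w $ j) = w a * e w $ i" if "w \<in> insert w0 Z" for w
      proof -
        have "w \<in> Y" using that insert.prems by auto
        then show ?thesis using e_eig[OF _ a i] eC T[OF a] i
          by (force simp: scalar_prod_def lessThan_atLeast0)
      qed
      have "0 = (\<Sum>j<m. T a $$ (i, j) * (\<Sum>w\<in>insert w0 Z. b w * e w $ j))"
        using insert.prems(2) by (intro sum.neutral[symmetric]) auto
      also have "\<dots> = (\<Sum>w\<in>insert w0 Z. b w * (\<Sum>j<m. T a $$ (i, j) * e w $ j))"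
        unfolding sum_distrib_left by (subst sum.swap) (simp add: mult_ac)
      also have "\<dots> = (\<Sum>w\<in>insert w0 Z. b w * w a * e w $ i)"
        by (intro sum.cong refl) (subst Te, auto)
      finally have "0 = (\<Sum>w\<in>insert w0 Z. b w * w a * e w $ i)
          - w0 a * (\<Sum>w\<in>insert w0 Z. b w * e w $ i)"
        using insert.prems(2)[OF i] by simp
      also have "\<dots> = (\<Sum>w\<in>insert w0 Z. b w * (w a - w0 a) * e w $ i)"
        unfolding sum_distrib_left by (subst sum_subtractf[symmetric]) (simp add: algebra_simps)
      also have "\<dots> = (\<Sum>w\<in>Z. b w * (w a - w0 a) * e w $ i)" using insert.hyps by simp
      finally show "(\<Sum>w\<in>Z. b w * (w a - w0 a) * e w $ i) = 0" by simp
    qed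
    have Z: "\<forall>w\<in>Z. b w = 0"
    proof
      fix w assume w: "w \<in> Z"
      then have "w \<noteq> w0" "w \<in> Y" "w0 \<in> Y" using insert by auto
      then obtain a where "a \<in> A" "w a \<noteq> w0 a" using diff by blast
      then show "b w = 0" using IH w by auto
    qed
    have w0: "w0 \<in> Y" using insert.prems by auto
    then obtain i where "i < m" "e w0 $ i \<noteq> 0" using eC by (metis eq_vecI carrier_vecD index_zero_vec)
    then have "b w0 = 0" using insert.prems(2)[of i] Z insert.hyps by simp
    with Z show ?case by simp
  qed
  \<comment> \<open>A coincidence e w = e w' would be a relation with coefficients 1 and -1.\<close>
  have inj: "inj_on e Y"
  proof (rule inj_onI, rule ccontr)
    fix w w' assume *: "w \<in> Y" "w' \<in> Y" "e w = e w'" "w \<noteq> w'"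
    then have "\<forall>x\<in>{w, w'}. (if x = w then 1 else -1 :: complex) = 0"
      by (intro indep) auto
    then show False by simp
  qed
  have eY: "e ` Y \<subseteq> carrier_vec m" using eC by auto
  have "lin_indpt (e ` Y)"
  proof (rule finite_lin_indpt2)
    show "finite (e ` Y)" using \<open>finite Y\<close> by simp
    show "e ` Y \<subseteq> carrier_vec m" using eY by simp
    fix b assume "lincomb b (e ` Y) = 0\<^sub>v m"
    then have "(\<Sum>w\<in>Y. b (e w) * e w $ i) = 0" if "i < m" for i
      using lincomb_index[OF that eY, of b] that by (simp add: sum.reindex[OF inj] module_vec_simps)
    then have "\<forall>w\<in>Y. b (e w) = 0" by (intro indep) auto
    then show "\<forall>v\<in>e ` Y. b v = 0" by simp
  qed
  then have "card (e ` Y) \<le> m" using li_le_dim(2)[OF fin_dim _ \<open>lin_indpt (e ` Y)\<close>] eY dim_is_n by simp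
  then show ?thesis by (simp add: card_image[OF inj])
qed

end

subsection \<open>Counting in elementary abelian groups\<close>

lemma card_le_fibre_mult_image:
  assumes "finite S" and "\<And>y. y \<in> f ` S \<Longrightarrow> card {x \<in> S. f x = y} \<le> N"
  shows "card S \<le> N * card (f ` S)"
proof -
  have "S = (\<Union>y\<in>f ` S. {x \<in> S. f x = y})" by auto
  then have "card S \<le> (\<Sum>y\<in>f ` S. card {x \<in> S. f x = y})"
    using card_UN_le[of "f ` S" "\<lambda>y. {x \<in> S. f x = y}"] assms(1) by simp
  also have "\<dots> \<le> (\<Sum>y\<in>f ` S. N)" using assms(2) by (rule sum_mono)
  finally show ?thesis by (simp add: mult.commute)
qed

locale elementary_abelian_group = comm_group G for G (structure) +
  fixes p n :: nat
  assumes prime_p: "prime p"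
    and card_carrier: "card (carrier G) = p ^ n"
    and exponent_p: "x \<in> carrier G \<Longrightarrow> x [^] p = \<one>"
begin

lemma finite_carrier: "finite (carrier G)"
  using card_carrier prime_gt_0_nat[OF prime_p] by (metis card.infinite not_gr_zero zero_less_power)

lemma card_subgroup:
  assumes "subgroup H G"
  obtains j where "j \<le> n" "card H = p ^ j"
proof -
  have "card (rcosets H) * card H = p ^ n"
    using lagrange_finite[OF finite_carrier assms] card_carrier by (simp add: Coset.order_def)
  then have "card H dvd p ^ n" by (metis dvd_triv_right)
  then show thesis using that divides_primepow_nat[OF prime_p] by blast
qed

lemma finite_subgroup: "subgroup H G \<Longrightarrow> finite H"
  using finite_carrier finite_subset subgroup.subset by blast

definition character_on :: "'a set \<Rightarrow> ('a \<Rightarrow> complex) \<Rightarrow> bool" where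
  "character_on H \<chi> \<longleftrightarrow>
     (\<forall>x\<in>H. \<forall>y\<in>H. \<chi> (x \<otimes> y) = \<chi> x * \<chi> y) \<and> (\<forall>x\<in>H. \<chi> x ^ p = 1)"

text \<open>Translation embeds each fibre of \<chi> into the kernel, and there are at most p fibres,
  the values being p-th roots of unity.\<close>

lemma card_le_character_kernel:
  assumes H: "subgroup H G" and \<chi>: "character_on H \<chi>"
  shows "subgroup {x \<in> H. \<chi> x = 1} G" "card H \<le> p * card {x \<in> H. \<chi> x = 1}"
proof -
  interpret H: subgroup H G by (rule H)
  have mult: "\<chi> (x \<otimes> y) = \<chi> x * \<chi> y" if "x \<in> H" "y \<in> H" for x y
    using that \<chi> by (auto simp: character_on_def)
  have nz: "\<chi> x \<noteq> 0" if "x \<in> H" for x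
    using that \<chi> prime_gt_0_nat[OF prime_p] by (auto simp: character_on_def power_0_left)
  have one: "\<chi> \<one> = 1" using mult[of \<one> \<one>] nz[of \<one>] by auto
  have inv: "\<chi> (inv x) * \<chi> x = 1" if "x \<in> H" for x
    using mult[of "inv x" x] that one by auto
  show "subgroup {x \<in> H. \<chi> x = 1} G"
    by (rule subgroup.intro) (use mult one inv in force)+
  have fibres: "card H \<le> card {x \<in> H. \<chi> x = 1} * card (\<chi> ` H)"
  proof (rule card_le_fibre_mult_image[OF finite_subgroup[OF H]])
    fix y assume "y \<in> \<chi> ` H"
    then obtain h where h: "h \<in> H" "y = \<chi> h" by auto
    have "inj_on (\<lambda>x. inv h \<otimes> x) {x \<in> H. \<chi> x = y}"
      using h by (intro inj_onI) auto
    moreover have "(\<lambda>x. inv h \<otimes> x) ` {x \<in> H. \<chi> x = y} \<subseteq> {x \<in> H. \<chi> x = 1}"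
      using h mult inv by auto
    ultimately show "card {x \<in> H. \<chi> x = y} \<le> card {x \<in> H. \<chi> x = 1}"
      using finite_subgroup[OF H] by (intro card_inj_on_le) auto
  qed
  have "card (\<chi> ` H) \<le> p"
  proof -
    have "\<chi> ` H \<subseteq> {z. z ^ p = 1}" using \<chi> by (auto simp: character_on_def)
    moreover have "finite {z::complex. z ^ p = 1}" "card {z::complex. z ^ p = 1} = p"
      using card_nth_roots[of 1 p] prime_gt_0_nat[OF prime_p] by (auto intro: card_ge_0_finite)
    ultimately show ?thesis by (metis card_mono)
  qed
  then have "card {x \<in> H. \<chi> x = 1} * card (\<chi> ` H) \<le> card {x \<in> H. \<chi> x = 1} * p"
    by (rule mult_le_mono2)
  with fibres have "card H \<le> card {x \<in> H. \<chi> x = 1} * p" by (rule le_trans)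
  then show "card H \<le> p * card {x \<in> H. \<chi> x = 1}" by (simp only: mult.commute)
qed

text \<open>Each character costs a factor of at most p; the remaining ones are restricted to its
  kernel, so the induction lets H vary.\<close>

lemma card_le_common_kernel:
  assumes "finite F" "subgroup H G" "\<And>\<chi>. \<chi> \<in> F \<Longrightarrow> character_on H \<chi>"
  shows "card H \<le> p ^ card F * card {x \<in> H. \<forall>\<chi>\<in>F. \<chi> x = 1}"
  using assms
proof (induction F arbitrary: H rule: finite_induct)
  case empty
  then show ?case by simp
next
  case (insert \<chi> F)
  let ?K = "{x \<in> H. \<chi> x = 1}"
  note ker = card_le_character_kernel[OF insert.prems(1), of \<chi>]
  have "card ?K \<le> p ^ card F * card {x \<in> ?K. \<forall>\<chi>\<in>F. \<chi> x = 1}"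
    using insert.prems ker by (intro insert.IH) (auto simp: character_on_def)
  then have "p * card ?K \<le> p * (p ^ card F * card {x \<in> ?K. \<forall>\<chi>\<in>F. \<chi> x = 1})" by (rule mult_le_mono2)
  moreover have "{x \<in> ?K. \<forall>\<chi>\<in>F. \<chi> x = 1} = {x \<in> H. \<forall>\<chi>\<in>insert \<chi> F. \<chi> x = 1}" by auto
  ultimately have "p * card ?K \<le> p ^ card (insert \<chi> F) * card {x \<in> H. \<forall>\<chi>\<in>insert \<chi> F. \<chi> x = 1}"
    using insert.hyps by (simp add: mult.assoc)
  then show ?case using ker(2) insert.prems by (meson insertI1 le_trans)
qed

text \<open>Adjoining an element outside a subgroup multiplies the order by at least p, so n - j
  elements suffice. Generation is phrased through subgroups K because it will be applied to an
  orthogonal complement.\<close>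

lemma exists_generators_over_subgroup:
  assumes "subgroup H G" "card H = p ^ j"
  obtains S where "S \<subseteq> carrier G" "card S \<le> n - j" "finite S"
    "\<And>K. subgroup K G \<Longrightarrow> H \<subseteq> K \<Longrightarrow> S \<subseteq> K \<Longrightarrow> K = carrier G"
proof -
  have "\<exists>S\<subseteq>carrier G. card S \<le> n - j \<and> finite S \<and>
          (\<forall>K. subgroup K G \<longrightarrow> H \<subseteq> K \<longrightarrow> S \<subseteq> K \<longrightarrow> K = carrier G)"
    using assms
  proof (induction "n - j" arbitrary: H j rule: less_induct)
    case less
    show ?case
    proof (cases "H = carrier G")
      case True
      then show ?thesis by (intro exI[of _ "{}"]) (auto dest: subgroup.subset)
    next
      case False
      have HG: "H \<subseteq> carrier G" using less.prems(1) by (rule subgroup.subset)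
      with False obtain g where g: "g \<in> carrier G" "g \<notin> H" by auto
      define H' where "H' = generate G (insert g H)"
      have H': "subgroup H' G" unfolding H'_def using g HG by (intro generate_is_subgroup) auto
      have sub: "insert g H \<subseteq> H'" by (auto simp: H'_def intro: generate.incl)
      obtain j' where j': "j' \<le> n" "card H' = p ^ j'" using card_subgroup[OF H'] by blast
      have "card H < card H'" using sub g finite_subgroup[OF H'] by (intro psubset_card_mono) auto
      then have "j < j'"
        using less.prems j' prime_gt_1_nat[OF prime_p] by (simp add: power_strict_increasing_iff)
      then have "n - j' < n - j" using j'(1) by linarith
      then obtain S where S: "S \<subseteq> carrier G" "card S \<le> n - j'" "finite S"
          "\<And>K. subgroup K G \<Longrightarrow> H' \<subseteq> K \<Longrightarrow> S \<subseteq> K \<Longrightarrow> K = carrier G"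
        using less.hyps[OF _ H' j'(2)] by blast
      have "card (insert g S) \<le> n - j" using S(2,3) \<open>j < j'\<close> j'(1) by (auto simp: card_insert_if)
      moreover have "K = carrier G" if "subgroup K G" "H \<subseteq> K" "insert g S \<subseteq> K" for K
        using that S(4) generate_subgroup_incl[of "insert g H" K] by (auto simp: H'_def)
      ultimately show ?thesis using S g by (intro exI[of _ "insert g S"]) auto
    qed
  qed
  then show thesis using that by blast
qed

end

subsection \<open>The commutator pairing and the weights of an isotropic subgroup\<close>

locale elementary_abelian_rep = elementary_abelian_group +
  fixes \<alpha> :: "'a \<Rightarrow> 'a \<Rightarrow> complex" and m :: nat and \<rho> :: "'a \<Rightarrow> complex mat"
  assumes cocycle: "cocycle2 G \<alpha>" and rep: "alpha_rep G \<alpha> m \<rho>" and m_pos: "m > 0"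
begin

text \<open>The scalar by which \<rho> g \<rho> h differs from \<rho> h \<rho> g, see
  \<open>\<rho>_commutator\<close>.\<close>

definition comm_char :: "'a \<Rightarrow> 'a \<Rightarrow> complex" where
  "comm_char g h = \<alpha> g h / \<alpha> h g"

lemma \<alpha>_nz: "g \<in> carrier G \<Longrightarrow> h \<in> carrier G \<Longrightarrow> \<alpha> g h \<noteq> 0"
  using cocycle by (auto simp: cocycle2_def)

lemma comm_char_nz: "g \<in> carrier G \<Longrightarrow> h \<in> carrier G \<Longrightarrow> comm_char g h \<noteq> 0"
  by (simp add: comm_char_def \<alpha>_nz)

lemma comm_char_self: "g \<in> carrier G \<Longrightarrow> comm_char g g = 1"
  by (simp add: comm_char_def \<alpha>_nz)

lemma comm_char_swap: "comm_char h g = inverse (comm_char g h)"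
  by (simp add: comm_char_def)

text \<open>As G is commutative, the cocycle identities at (g, h, k), (k, g, h) and (g, k, h) share
  their mixed terms, which can be eliminated.\<close>

lemma comm_char_mult_left:
  assumes "g \<in> carrier G" "h \<in> carrier G" "k \<in> carrier G"
  shows "comm_char (g \<otimes> h) k = comm_char g k * comm_char h k"
proof -
  have coc: "\<alpha> x y * \<alpha> (x \<otimes> y) z = \<alpha> y z * \<alpha> x (y \<otimes> z)"
    if "x \<in> carrier G" "y \<in> carrier G" "z \<in> carrier G" for x y z
    using cocycle that by (auto simp: cocycle2_def)
  note nz = \<alpha>_nz[OF assms(1,2)] \<alpha>_nz[OF assms(1,3)] \<alpha>_nz[OF assms(2,3)] \<alpha>_nz[OF assms(3,1)]
    \<alpha>_nz[OF assms(3,2)] \<alpha>_nz[OF m_closed[OF assms(1,2)] assms(3)]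
    \<alpha>_nz[OF assms(3) m_closed[OF assms(1,2)]] \<alpha>_nz[OF m_closed[OF assms(1,3)] assms(2)]
    \<alpha>_nz[OF assms(1) m_closed[OF assms(2,3)]]
  have 1: "\<alpha> g h * \<alpha> (g \<otimes> h) k = \<alpha> h k * \<alpha> g (h \<otimes> k)" using coc assms by simp
  have 2: "\<alpha> k g * \<alpha> (g \<otimes> k) h = \<alpha> g h * \<alpha> k (g \<otimes> h)"
    using coc[of k g h] assms by (simp add: m_comm)
  have 3: "\<alpha> g k * \<alpha> (g \<otimes> k) h = \<alpha> k h * \<alpha> g (h \<otimes> k)"
    using coc[of g k h] assms by (simp add: m_comm)
  \<comment> \<open>The extra factor \<alpha> g h lets the three identities be substituted in turn;
    it is cancelled afterwards.\<close>
  have "\<alpha> g h * (\<alpha> (g \<otimes> h) k * (\<alpha> k g * \<alpha> k h)) = \<alpha> g h * (\<alpha> g k * \<alpha> h k * \<alpha> k (g \<otimes> h))"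
  proof -
    have "\<alpha> g h * (\<alpha> (g \<otimes> h) k * (\<alpha> k g * \<alpha> k h)) = (\<alpha> g h * \<alpha> (g \<otimes> h) k) * (\<alpha> k g * \<alpha> k h)"
      by (simp only: mult_ac)
    also have "\<dots> = \<alpha> h k * \<alpha> k g * (\<alpha> k h * \<alpha> g (h \<otimes> k))" unfolding 1 by (simp only: mult_ac)
    also have "\<dots> = \<alpha> h k * \<alpha> g k * (\<alpha> k g * \<alpha> (g \<otimes> k) h)"
      unfolding 3[symmetric] by (simp only: mult_ac)
    also have "\<dots> = \<alpha> g h * (\<alpha> g k * \<alpha> h k * \<alpha> k (g \<otimes> h))" unfolding 2 by (simp only: mult_ac)
    finally show ?thesis .
  qed
  then have "\<alpha> (g \<otimes> h) k * (\<alpha> k g * \<alpha> k h) = \<alpha> g k * \<alpha> h k * \<alpha> k (g \<otimes> h)" using nz by simp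
  then show ?thesis using nz by (simp add: comm_char_def frac_eq_eq)
qed

lemma comm_char_mult_right:
  assumes "g \<in> carrier G" "h \<in> carrier G" "k \<in> carrier G"
  shows "comm_char k (g \<otimes> h) = comm_char k g * comm_char k h"
  using comm_char_mult_left[OF assms]
  by (simp add: comm_char_swap[of k] inverse_mult_distrib)

lemma comm_char_one_left: "h \<in> carrier G \<Longrightarrow> comm_char \<one> h = 1"
  using comm_char_mult_left[of \<one> \<one> h] comm_char_nz[of \<one> h] by simp

lemma comm_char_one_right: "h \<in> carrier G \<Longrightarrow> comm_char h \<one> = 1"
  by (simp add: comm_char_swap[of h] comm_char_one_left)

lemma comm_char_inv_left:
  assumes "g \<in> carrier G" "h \<in> carrier G"
  shows "comm_char (inv g) h = inverse (comm_char g h)"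
  using comm_char_mult_left[of "inv g" g h] comm_char_one_left[of h] assms comm_char_nz[OF assms]
  by (simp add: field_simps)

lemma comm_char_pow_left:
  fixes k :: nat
  assumes "g \<in> carrier G" "h \<in> carrier G"
  shows "comm_char (g [^] k) h = comm_char g h ^ k"
  by (induction k) (use assms comm_char_mult_left comm_char_one_left in \<open>auto simp: mult.commute\<close>)

lemma comm_char_exponent: "g \<in> carrier G \<Longrightarrow> h \<in> carrier G \<Longrightarrow> comm_char g h ^ p = 1"
  using comm_char_pow_left[of g h p] exponent_p[of g] comm_char_one_left[of h] by simp

section \<open>Action of the representation on vectors\<close>

lemma \<rho>_carrier: "g \<in> carrier G \<Longrightarrow> \<rho> g \<in> carrier_mat m m"
  using rep by (auto simp: alpha_rep_def)

lemma \<rho>_one: "\<rho> \<one> = 1\<^sub>m m"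
  using rep by (auto simp: alpha_rep_def)

lemma \<rho>_mult_vec:
  assumes "g \<in> carrier G" "h \<in> carrier G" "v \<in> carrier_vec m"
  shows "\<rho> g *\<^sub>v (\<rho> h *\<^sub>v v) = \<alpha> g h \<cdot>\<^sub>v (\<rho> (g \<otimes> h) *\<^sub>v v)"
proof -
  have "\<rho> g *\<^sub>v (\<rho> h *\<^sub>v v) = (\<rho> g * \<rho> h) *\<^sub>v v"
    using assms \<rho>_carrier by (metis assoc_mult_mat_vec)
  also have "\<rho> g * \<rho> h = \<alpha> g h \<cdot>\<^sub>m \<rho> (g \<otimes> h)" using rep assms by (auto simp: alpha_rep_def)
  also have "\<dots> *\<^sub>v v = \<alpha> g h \<cdot>\<^sub>v (\<rho> (g \<otimes> h) *\<^sub>v v)"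
    using \<rho>_carrier[of "g \<otimes> h"] assms by (intro eq_vecI) auto
  finally show ?thesis .
qed

lemma \<rho>_commutator:
  assumes "g \<in> carrier G" "h \<in> carrier G"
  shows "\<rho> g * \<rho> h = comm_char g h \<cdot>\<^sub>m (\<rho> h * \<rho> g)"
proof -
  have "\<rho> g * \<rho> h = \<alpha> g h \<cdot>\<^sub>m \<rho> (g \<otimes> h)" "\<rho> h * \<rho> g = \<alpha> h g \<cdot>\<^sub>m \<rho> (g \<otimes> h)"
    using rep assms by (auto simp: alpha_rep_def m_comm)
  then show ?thesis using \<alpha>_nz[OF assms(2,1)] by (intro eq_matI) (auto simp: comm_char_def)
qed

lemma \<rho>_commutator_vec:
  assumes "g \<in> carrier G" "h \<in> carrier G" "v \<in> carrier_vec m"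
  shows "\<rho> g *\<^sub>v (\<rho> h *\<^sub>v v) = comm_char g h \<cdot>\<^sub>v (\<rho> h *\<^sub>v (\<rho> g *\<^sub>v v))"
  using assms \<alpha>_nz[OF assms(2,1)]
  by (simp add: \<rho>_mult_vec m_comm comm_char_def smult_smult_assoc)

text \<open>\<rho> (inv g) undoes \<rho> g up to the nonzero factor \<alpha> (inv g) g.\<close>

lemma \<rho>_vec_nz:
  assumes g: "g \<in> carrier G" and v: "v \<in> carrier_vec m" "v \<noteq> 0\<^sub>v m"
  shows "\<rho> g *\<^sub>v v \<noteq> 0\<^sub>v m"
proof
  assume "\<rho> g *\<^sub>v v = 0\<^sub>v m"
  then have "\<alpha> (inv g) g \<cdot>\<^sub>v (1\<^sub>m m *\<^sub>v v) = \<rho> (inv g) *\<^sub>v 0\<^sub>v m"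
    using \<rho>_mult_vec[of "inv g" g v] g v by (simp add: \<rho>_one)
  also have "\<dots> = 0\<^sub>v m" using \<rho>_carrier[of "inv g"] g by (intro eq_vecI) auto
  finally have 0: "\<alpha> (inv g) g \<cdot>\<^sub>v v = 0\<^sub>v m" using v by simp
  have "v $ i = 0" if "i < m" for i
  proof -
    have "(\<alpha> (inv g) g \<cdot>\<^sub>v v) $ i = 0" using 0 that by simp
    then show ?thesis using that v \<alpha>_nz[of "inv g" g] g by auto
  qed
  then have "v = 0\<^sub>v m" using v by (intro eq_vecI) auto
  with v show False by simp
qed

text \<open>For k = p the right-hand side is a multiple of v, since g^p = 1; this supplies the
  assumption \<open>pow\<close> of \<open>commuting_family\<close>.\<close>

lemma \<rho>_funpow:
  assumes "g \<in> carrier G" "v \<in> carrier_vec m"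
  shows "((*\<^sub>v) (\<rho> g) ^^ k) v = (\<Prod>i<k. \<alpha> g (g [^] i)) \<cdot>\<^sub>v (\<rho> (g [^] k) *\<^sub>v v)"
proof (induction k)
  case 0
  then show ?case using assms by (simp add: \<rho>_one one_smult_vec)
next
  case (Suc k)
  have "((*\<^sub>v) (\<rho> g) ^^ Suc k) v = \<rho> g *\<^sub>v ((\<Prod>i<k. \<alpha> g (g [^] i)) \<cdot>\<^sub>v (\<rho> (g [^] k) *\<^sub>v v))"
    using Suc by simp
  also have "\<dots> = (\<Prod>i<k. \<alpha> g (g [^] i)) \<cdot>\<^sub>v (\<rho> g *\<^sub>v (\<rho> (g [^] k) *\<^sub>v v))"
    using assms \<rho>_carrier by (intro mult_mat_vec) (auto intro!: mult_mat_vec_carrier)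
  also have "\<dots> = (\<Prod>i<Suc k. \<alpha> g (g [^] i)) \<cdot>\<^sub>v (\<rho> (g [^] Suc k) *\<^sub>v v)"
  proof -
    have "g \<otimes> g [^] k = g [^] Suc k" using assms by (simp add: m_comm)
    then show ?thesis using assms by (simp add: \<rho>_mult_vec smult_smult_assoc del: nat_pow_Suc)
  qed
  finally show ?case .
qed

section \<open>Isotropic sets and their weights\<close>

definition isotropic :: "'a set \<Rightarrow> bool" where
  "isotropic B \<longleftrightarrow> B \<subseteq> carrier G \<and> (\<forall>a\<in>B. \<forall>b\<in>B. comm_char a b = 1)"

text \<open>A is maximal among isotropic subsets, not subgroups. An element x perpendicular to A can
  be added to it because comm_char x x = 1, so x already lies in A; closure under the group
  operations is a consequence.\<close>

lemma exists_self_perpendicular: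
  obtains A where "subgroup A G" "isotropic A"
    "\<And>x. x \<in> carrier G \<Longrightarrow> (\<And>a. a \<in> A \<Longrightarrow> comm_char x a = 1) \<Longrightarrow> x \<in> A"
proof -
  have "finite {B. isotropic B}"
    by (rule finite_subset[of _ "Pow (carrier G)"]) (auto simp: isotropic_def finite_carrier)
  moreover have "{} \<in> {B. isotropic B}" by (simp add: isotropic_def)
  ultimately obtain A where A: "isotropic A" and max: "\<And>B. isotropic B \<Longrightarrow> A \<subseteq> B \<Longrightarrow> A = B"
    by (metis (mono_tags, lifting) empty_iff finite_has_maximal mem_Collect_eq)
  have AG: "a \<in> carrier G" and iso: "b \<in> A \<Longrightarrow> comm_char a b = 1" if "a \<in> A" for a b
    using A that by (auto simp: isotropic_def)
  have perp: "x \<in> A" if x: "x \<in> carrier G" "\<And>a. a \<in> A \<Longrightarrow> comm_char x a = 1" for x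
  proof -
    have "comm_char a x = 1" if "a \<in> A" for a using x(2)[OF that] comm_char_swap[of a x] by simp
    then have "isotropic (insert x A)"
      using A x comm_char_self[of x] by (auto simp: isotropic_def)
    then show ?thesis using max by blast
  qed
  have "subgroup A G"
  proof (rule subgroup.intro)
    show "A \<subseteq> carrier G" using AG by auto
    show "x \<otimes> y \<in> A" if "x \<in> A" "y \<in> A" for x y
      using that by (intro perp) (simp_all add: AG iso comm_char_mult_left)
    show "\<one> \<in> A" by (intro perp) (simp_all add: AG comm_char_one_left)
    show "inv x \<in> A" if "x \<in> A" for x
      using that by (intro perp) (simp_all add: AG iso comm_char_inv_left)
  qed
  with A perp show thesis using that by blast
qed

lemma commuting_family_isotropic:
  assumes "isotropic A"
  shows "commuting_family \<rho> A m p (\<lambda>a. \<Prod>i<p. \<alpha> a (a [^] i))"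
proof
  show "finite A" using assms finite_subset finite_carrier by (auto simp: isotropic_def)
  show "p > 0" using prime_gt_0_nat[OF prime_p] .
next
  fix a assume "a \<in> A"
  then have a: "a \<in> carrier G" using assms by (auto simp: isotropic_def)
  show "\<rho> a \<in> carrier_mat m m" using \<rho>_carrier[OF a] .
  show "(\<Prod>i<p. \<alpha> a (a [^] i)) \<noteq> 0" using a \<alpha>_nz by simp
  show "((*\<^sub>v) (\<rho> a) ^^ p) v = (\<Prod>i<p. \<alpha> a (a [^] i)) \<cdot>\<^sub>v v" if "v \<in> carrier_vec m" for v
    using \<rho>_funpow[OF a that, of p] that by (simp add: exponent_p[OF a] \<rho>_one)
next
  fix a b assume "a \<in> A" "b \<in> A"
  then have "a \<in> carrier G" "b \<in> carrier G" "comm_char a b = 1"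
    using assms by (auto simp: isotropic_def)
  then show "\<rho> a * \<rho> b = \<rho> b * \<rho> a"
    using \<rho>_commutator[of a b] by (auto intro!: eq_matI)
qed

text \<open>The weights of a maximal isotropic subgroup \<open>A\<close> are permuted freely by \<open>G / A\<close>, of order
  \<open>p ^ k\<close>; \<open>c\<close> is the number of orbits. Faithfulness forces the ratios of weights in different orbits,
  together with the characters \<open>comm_char _ s\<close> for \<open>k\<close> generators \<open>s\<close> of \<open>G\<close> over \<open>A\<close>, to separate
  the points of \<open>A\<close>.\<close>

lemma degree_lower_bound:
  assumes faithful: "\<And>g c. g \<in> carrier G \<Longrightarrow> \<rho> g = c \<cdot>\<^sub>m 1\<^sub>m m \<Longrightarrow> g = \<one>"
  obtains k c where "c \<ge> 1" "n + 1 \<le> 2 * k + c" "c * p ^ k \<le> m"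
proof -
  obtain A where sub: "subgroup A G" and A: "isotropic A" and
    perp: "\<And>x. x \<in> carrier G \<Longrightarrow> (\<And>a. a \<in> A \<Longrightarrow> comm_char x a = 1) \<Longrightarrow> x \<in> A"
    using exists_self_perpendicular by blast
  have AG: "a \<in> carrier G" if "a \<in> A" for a using A that by (auto simp: isotropic_def)
  interpret A: subgroup A G by (rule sub)
  interpret cf: commuting_family \<rho> A m p "\<lambda>a. \<Prod>i<p. \<alpha> a (a [^] i)"
    by (rule commuting_family_isotropic[OF A])
  obtain j where j: "j \<le> n" "card A = p ^ j" using card_subgroup[OF sub] by blast
  \<comment> \<open>Thus A has index p^k.\<close>
  define k where "k = n - j"

  \<comment> \<open>Weights are normalized outside A so that each is counted once.\<close>
  define X where "X = {w \<in> extensional A. \<exists>v. cf.joint_eigenvector w v}"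
  have restrict_X: "restrict w A \<in> X" if "cf.joint_eigenvector w v" for w v
    using that by (auto simp: X_def cf.joint_eigenvector_def)
  have finX: "finite X"
  proof (rule ccontr)
    assume "infinite X"
    then obtain Y where "finite Y" "card Y = Suc m" "Y \<subseteq> X"
      using infinite_arbitrarily_large by blast
    then show False using cf.card_weights_le[of Y] by (auto simp: X_def)
  qed
  have cardX: "card X \<le> m" using cf.card_weights_le[OF finX] by (auto simp: X_def)
  have Xne: "X \<noteq> {}"
  proof -
    have "unit_vec m 0 \<noteq> (0\<^sub>v m :: complex vec)"
      using m_pos by (metis index_unit_vec(2) index_zero_vec(1) zero_neq_one)
    then obtain u w where "cf.joint_eigenvector w u"
      using cf.exists_joint_eigenvector[of "carrier_vec m" "unit_vec m 0"] cf.T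
      by (metis add_carrier_vec mult_mat_vec_carrier smult_carrier_vec subset_refl unit_vec_carrier)
    then show ?thesis using restrict_X by blast
  qed
  \<comment> \<open>Weights are \<alpha>-twisted characters of A, so the quotient of two of them is
    a genuine character.\<close>
  have wt_mult: "w a * w b = \<alpha> a b * w (a \<otimes> b)" and wt_nz: "w a \<noteq> 0"
    if w: "w \<in> X" and ab: "a \<in> A" "b \<in> A" for w a b
  proof -
    obtain v where v: "v \<in> carrier_vec m" "v \<noteq> 0\<^sub>v m" "\<And>a. a \<in> A \<Longrightarrow> \<rho> a *\<^sub>v v = w a \<cdot>\<^sub>v v"
      using w by (auto simp: X_def cf.joint_eigenvector_def)
    obtain i where i: "i < m" "v $ i \<noteq> 0" using v by (metis eq_vecI carrier_vecD index_zero_vec)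
    have "(\<rho> a *\<^sub>v (\<rho> b *\<^sub>v v)) = (w b * w a) \<cdot>\<^sub>v v"
      using v ab mult_mat_vec[OF cf.T[OF ab(1)] v(1)] by (simp add: smult_smult_assoc)
    moreover have "\<rho> a *\<^sub>v (\<rho> b *\<^sub>v v) = (\<alpha> a b * w (a \<otimes> b)) \<cdot>\<^sub>v v"
      using \<rho>_mult_vec[OF AG AG v(1)] ab v(3)[of "a \<otimes> b"] by (simp add: smult_smult_assoc)
    ultimately have "((w b * w a) \<cdot>\<^sub>v v) $ i = ((\<alpha> a b * w (a \<otimes> b)) \<cdot>\<^sub>v v) $ i" by simp
    then show "w a * w b = \<alpha> a b * w (a \<otimes> b)" using i v by (simp add: mult.commute)
    show "w a \<noteq> 0"
      using \<rho>_vec_nz[OF AG[OF ab(1)] v(1,2)] v(3)[OF ab(1)] v(1) by auto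
  qed

  \<comment> \<open>By the commutator relation, \<rho> g carries an eigenvector of weight w to one
    of weight \<open>act g w\<close>.\<close>
  define act where "act g w = (\<lambda>a\<in>A. comm_char a g * w a)" for g w
  have act_X: "act g w \<in> X" if w: "w \<in> X" and g: "g \<in> carrier G" for g w
  proof -
    obtain v where v: "v \<in> carrier_vec m" "v \<noteq> 0\<^sub>v m" "\<And>a. a \<in> A \<Longrightarrow> \<rho> a *\<^sub>v v = w a \<cdot>\<^sub>v v"
      using w by (auto simp: X_def cf.joint_eigenvector_def)
    have "\<rho> a *\<^sub>v (\<rho> g *\<^sub>v v) = act g w a \<cdot>\<^sub>v (\<rho> g *\<^sub>v v)" if a: "a \<in> A" for a
      using \<rho>_commutator_vec[OF AG[OF a] g v(1)] v(3)[OF a] a mult_mat_vec[OF \<rho>_carrier[OF g] v(1)]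
      by (simp add: act_def smult_smult_assoc)
    then have "cf.joint_eigenvector (act g w) (\<rho> g *\<^sub>v v)"
      using \<rho>_vec_nz[OF g v(1,2)] mult_mat_vec_carrier[OF \<rho>_carrier[OF g] v(1)]
      by (simp add: cf.joint_eigenvector_def)
    then show ?thesis by (auto simp: X_def act_def)
  qed
  have act_act: "act g (act h w) = act (g \<otimes> h) w" if "g \<in> carrier G" "h \<in> carrier G" for g h w
    using that AG by (auto simp: act_def comm_char_mult_right intro!: restrict_ext)
  have act_one: "act \<one> w = w" if "w \<in> X" for w
    using that AG by (auto simp: act_def X_def comm_char_one_right intro!: extensionalityI[of _ A])

  define r where "r = {(w, act g w) |w g. w \<in> X \<and> g \<in> carrier G}"
  have rI: "(w, act g w) \<in> r" if "w \<in> X" "g \<in> carrier G" for w g using that by (auto simp: r_def)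
  have "equiv X r"
  proof (rule equivI)
    show "r \<subseteq> X \<times> X" using act_X by (auto simp: r_def)
    show "refl_on X r"
      using rI[OF _ one_closed] act_one by (auto simp: refl_on_def)
    show "sym r"
    proof (rule symI)
      fix w w' assume "(w, w') \<in> r"
      then obtain g where g: "w \<in> X" "g \<in> carrier G" "w' = act g w" by (auto simp: r_def)
      then have "w = act (inv g) w'" by (simp add: act_act act_one)
      then show "(w', w) \<in> r" using rI[of w' "inv g"] g act_X by simp
    qed
    show "trans r"
    proof (rule transI)
      fix w w' w'' assume "(w, w') \<in> r" "(w', w'') \<in> r"
      then obtain g h where "w \<in> X" "g \<in> carrier G" "h \<in> carrier G" "w'' = act h (act g w)"
        by (auto simp: r_def)
      then show "(w, w'') \<in> r" using rI[of w "h \<otimes> g"] by (simp add: act_act)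
    qed
  qed
  \<comment> \<open>If g and h move w alike, then inv h g is perpendicular to A, hence in A; so the
    fibres of the orbit map have at most card A elements.\<close>
  have orbit_card: "p ^ k \<le> card (r `` {w})" if w: "w \<in> X" for w
  proof -
    have orb: "r `` {w} = (\<lambda>g. act g w) ` carrier G" using w by (auto simp: r_def)
    have "card (carrier G) \<le> card A * card ((\<lambda>g. act g w) ` carrier G)"
    proof (rule card_le_fibre_mult_image[OF finite_carrier])
      fix y assume "y \<in> (\<lambda>g. act g w) ` carrier G"
      then obtain h where h: "h \<in> carrier G" "y = act h w" by auto
      have "inv h \<otimes> g \<in> A" if g: "g \<in> carrier G" "act g w = y" for g
      proof (rule perp)
        fix a assume a: "a \<in> A"
        have "act g w a = act h w a" using g h by simp
        then have "comm_char a g = comm_char a h" using a wt_nz[OF w a a] by (simp add: act_def)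
        then show "comm_char (inv h \<otimes> g) a = 1"
          using g h AG[OF a] comm_char_nz[OF h(1) AG[OF a]]
          by (simp add: comm_char_mult_left comm_char_inv_left comm_char_swap[of a])
      qed (use g h in auto)
      then have "(\<lambda>x. inv h \<otimes> x) ` {g \<in> carrier G. act g w = y} \<subseteq> A" by auto
      moreover have "inj_on (\<lambda>x. inv h \<otimes> x) {g \<in> carrier G. act g w = y}"
        using h by (intro inj_onI) auto
      ultimately show "card {g \<in> carrier G. act g w = y} \<le> card A"
        using finite_subgroup[OF sub] by (intro card_inj_on_le)
    qed
    then have "p ^ j * p ^ k \<le> p ^ j * card (r `` {w})"
      unfolding orb card_carrier j(2) using j(1) by (simp add: k_def flip: power_add)
    then show ?thesis using prime_gt_0_nat[OF prime_p] by simp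
  qed

  \<comment> \<open>The set of orbits; its cardinality is the c of the statement.\<close>
  define C where "C = X // r"
  have finC: "finite C" and UC: "\<Union>C = X"
    using finX \<open>equiv X r\<close> by (auto simp: C_def Union_quotient finite_quotient equiv_def)
  have "card C * p ^ k \<le> m"
  proof -
    have fin: "finite Y" if "Y \<in> C" for Y using that UC finX by (metis Union_upper finite_subset)
    have "card C * p ^ k = (\<Sum>Y\<in>C. p ^ k)" by simp
    also have "\<dots> \<le> (\<Sum>Y\<in>C. card Y)"
      using orbit_card by (intro sum_mono) (auto simp: C_def quotient_def)
    also have "\<dots> = card X"
      unfolding UC[symmetric] using quotient_disj[OF \<open>equiv X r\<close>] fin
      by (intro card_Union_disjoint[symmetric]) (auto simp: C_def pairwise_def disjnt_def)
    finally show ?thesis using cardX by simp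
  qed
  moreover have "n + 1 \<le> 2 * k + card C"
  proof -
    obtain Y0 where Y0: "Y0 \<in> C" using Xne UC by blast
    have "\<exists>w. w \<in> Y" if "Y \<in> C" for Y
      using that in_quotient_imp_non_empty[OF \<open>equiv X r\<close>] by (auto simp: C_def)
    then obtain rep where rep: "rep Y \<in> Y" if "Y \<in> C" for Y by metis
    have rep_X: "rep Y \<in> X" if "Y \<in> C" for Y using rep[OF that] UC that by blast
    obtain S where S: "S \<subseteq> carrier G" "card S \<le> n - j" "finite S"
      "\<And>K. subgroup K G \<Longrightarrow> A \<subseteq> K \<Longrightarrow> S \<subseteq> K \<Longrightarrow> K = carrier G"
      using exists_generators_over_subgroup[OF sub j(2)] by blast
    \<comment> \<open>At most (c - 1) + k characters of A: quotients of orbit representatives by the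
      one of a base orbit, and pairings with the generators of G over A.\<close>
    define F where "F = (\<lambda>Y a. rep Y a / rep Y0 a) ` (C - {Y0}) \<union> (\<lambda>s a. comm_char a s) ` S"
    have "finite F" using finC S by (auto simp: F_def)
    have "card F \<le> card (C - {Y0}) + card S"
      unfolding F_def by (intro order.trans[OF card_Un_le] add_mono card_image_le) (use finC S in auto)
    then have cardF: "card F \<le> (card C - 1) + k"
      using S(2) Y0 finC by (simp add: k_def)
    have "character_on A \<chi>" if "\<chi> \<in> F" for \<chi>
      using that unfolding F_def
    proof
      assume "\<chi> \<in> (\<lambda>s a. comm_char a s) ` S"
      then show ?thesis
        using S(1) AG by (auto simp: character_on_def comm_char_mult_left comm_char_exponent)
    next
      assume "\<chi> \<in> (\<lambda>Y a. rep Y a / rep Y0 a) ` (C - {Y0})"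
      then obtain Y where Y: "Y \<in> C" and \<chi>: "\<chi> = (\<lambda>a. rep Y a / rep Y0 a)" by auto
      note wY = rep_X[OF Y] and w0 = rep_X[OF Y0]
      have mult: "\<chi> (a \<otimes> b) = \<chi> a * \<chi> b" if ab: "a \<in> A" "b \<in> A" for a b
        using wt_mult[OF wY ab] wt_mult[OF w0 ab] wt_nz[OF w0 _ ab(1)] ab \<alpha>_nz[OF AG AG, of a b]
        by (simp add: \<chi>)
      have nz: "\<chi> a \<noteq> 0" if "a \<in> A" for a
        using that wt_nz[OF wY that that] wt_nz[OF w0 that that] by (simp add: \<chi>)
      have one: "\<chi> \<one> = 1" using mult[of \<one> \<one>] nz[of \<one>] by simp
      have "\<chi> (a [^] i) = \<chi> a ^ i \<and> a [^] i \<in> A" if "a \<in> A" for a and i :: nat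
        by (induction i) (use that mult one in auto)
      then have "\<chi> a ^ p = 1" if "a \<in> A" for a
        using that exponent_p[OF AG[OF that]] one by metis
      with mult show ?thesis by (auto simp: character_on_def)
    qed
    then have ker: "card A \<le> p ^ card F * card {x \<in> A. \<forall>\<chi>\<in>F. \<chi> x = 1}"
      by (rule card_le_common_kernel[OF \<open>finite F\<close> sub])
    \<comment> \<open>An x in the common kernel pairs trivially with A and S, hence with all of G,
      so the weights of one orbit agree at x; the trivial quotients extend this across orbits. With
      all weights equal at x, \<rho> x is scalar.\<close>
    have "{x \<in> A. \<forall>\<chi>\<in>F. \<chi> x = 1} \<subseteq> {\<one>}"
    proof clarify
      fix x assume x: "x \<in> A" "\<forall>\<chi>\<in>F. \<chi> x = 1"
      define K where "K = {g \<in> carrier G. comm_char x g = 1}"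
      have "K = carrier G"
      proof (rule S(4))
        show "subgroup K G"
        proof (rule subgroup.intro)
          show "inv g \<in> K" if "g \<in> K" for g
            using that AG[OF x(1)] comm_char_inv_left[of g x]
            by (auto simp: K_def comm_char_swap[of x])
        qed (use AG[OF x(1)] in \<open>auto simp: K_def comm_char_mult_right comm_char_one_right\<close>)
        show "A \<subseteq> K" using A x by (auto simp: K_def isotropic_def)
        show "S \<subseteq> K" using S(1) x by (auto simp: K_def F_def)
      qed
      have const: "w x = rep Y0 x" if w: "w \<in> X" for w
      proof -
        obtain Y where Y: "Y \<in> C" "w \<in> Y" using w UC by blast
        have "(rep Y, w) \<in> r"
          using quotient_eqI[OF \<open>equiv X r\<close>] Y rep[OF Y(1)] in_quotient_imp_in_rel[OF \<open>equiv X r\<close>, of Y]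
          by (auto simp: C_def)
        then obtain g where "g \<in> carrier G" "w = act g (rep Y)" by (auto simp: r_def)
        then have "w x = rep Y x" using x \<open>K = carrier G\<close> by (auto simp: act_def K_def)
        also have "rep Y x = rep Y0 x"
        proof (cases "Y = Y0")
          case False
          with Y have "(\<lambda>a. rep Y a / rep Y0 a) \<in> F" unfolding F_def by blast
          with x(2) have "rep Y x / rep Y0 x = 1" by fast
          then show ?thesis by (simp add: divide_eq_1_iff)
        qed simp
        finally show ?thesis .
      qed
      have "w x = rep Y0 x" if "cf.joint_eigenvector w v" for w v
        using const[OF restrict_X[OF that]] x by simp
      then have "\<rho> x = rep Y0 x \<cdot>\<^sub>m 1\<^sub>m m" by (rule cf.scalar_of_constant_weight[OF x(1)])
      then show "x = \<one>" using faithful AG x by blast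
    qed
    then have "card {x \<in> A. \<forall>\<chi>\<in>F. \<chi> x = 1} \<le> 1"
      using card_mono[of "{\<one>}"] by fastforce
    then have "p ^ card F * card {x \<in> A. \<forall>\<chi>\<in>F. \<chi> x = 1} \<le> p ^ card F" by simp
    with ker have "p ^ j \<le> p ^ card F" unfolding j(2) by (rule le_trans)
    \<comment> \<open>This gives j \<le> (c - 1) + k, where n = j + k.\<close>
    then have "j \<le> card F" using power_le_imp_le_exp prime_gt_1_nat[OF prime_p] by blast
    moreover have "card C \<ge> 1" using Y0 finC by (auto simp: Suc_le_eq card_gt_0_iff)
    ultimately show ?thesis using cardF j(1) by (simp add: k_def)
  qed
  moreover have "card C \<ge> 1"
    using Xne UC finC by (auto simp: Suc_le_eq card_gt_0_iff)
  ultimately show thesis using that by blast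
qed

end

subsection \<open>Representations attaining the bound\<close>

lemma faithful_proj_rep_iso:
  assumes "group G" "group H" and f: "f \<in> iso G H" and rep: "faithful_proj_rep H m \<rho>"
  shows "faithful_proj_rep G m (\<rho> \<circ> f)"
proof -
  interpret G: group G by fact
  interpret H: group H by fact
  interpret f: group_hom G H f using f by unfold_locales (auto simp: iso_def)
  have mult: "f (g \<otimes>\<^bsub>G\<^esub> h) = f g \<otimes>\<^bsub>H\<^esub> f h" if "g \<in> carrier G" "h \<in> carrier G" for g h
    using that by simp
  have inj: "inj_on f (carrier G)" using f by (auto simp: iso_def bij_betw_def)
  obtain \<alpha> where \<alpha>: "cocycle2 H \<alpha>" "alpha_rep H \<alpha> m \<rho>"
    using rep by (auto simp: faithful_proj_rep_def)
  have "cocycle2 G (\<lambda>g h. \<alpha> (f g) (f h))" using \<alpha>(1) by (simp add: cocycle2_def)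
  moreover have "alpha_rep G (\<lambda>g h. \<alpha> (f g) (f h)) m (\<rho> \<circ> f)"
    using \<alpha>(2) by (simp add: alpha_rep_def)
  moreover have "g = \<one>\<^bsub>G\<^esub>" if g: "g \<in> carrier G" "(\<rho> \<circ> f) g = c \<cdot>\<^sub>m 1\<^sub>m m" for g c
  proof -
    have "f g = \<one>\<^bsub>H\<^esub>" using rep g by (auto simp: faithful_proj_rep_def)
    then show ?thesis using inj g by (metis G.one_closed f.hom_one inj_onD)
  qed
  ultimately show ?thesis by (auto simp: faithful_proj_rep_def)
qed

text \<open>Invertibility comes from a multiple of \<rho> (inv g). The cocycle identity is
  associativity of matrix multiplication, read off at a nonzero entry of \<rho> (g h k).\<close>

lemma faithful_proj_repI:
  assumes "group G" and m: "m > 0"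
    and \<rho>: "\<And>g. g \<in> carrier G \<Longrightarrow> \<rho> g \<in> carrier_mat m m" "\<rho> \<one>\<^bsub>G\<^esub> = 1\<^sub>m m"
    and mult: "\<And>g h. g \<in> carrier G \<Longrightarrow> h \<in> carrier G \<Longrightarrow> \<rho> g * \<rho> h = \<alpha> g h \<cdot>\<^sub>m \<rho> (g \<otimes>\<^bsub>G\<^esub> h)"
    and nz: "\<And>g h. g \<in> carrier G \<Longrightarrow> h \<in> carrier G \<Longrightarrow> \<alpha> g h \<noteq> 0"
    and faithful: "\<And>g c. g \<in> carrier G \<Longrightarrow> \<rho> g = c \<cdot>\<^sub>m 1\<^sub>m m \<Longrightarrow> g = \<one>\<^bsub>G\<^esub>"
  shows "faithful_proj_rep G m \<rho>"
proof -
  interpret group G by fact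
  have inverse: "\<rho> g * ((1 / \<alpha> g (inv\<^bsub>G\<^esub> g)) \<cdot>\<^sub>m \<rho> (inv\<^bsub>G\<^esub> g)) = 1\<^sub>m m" if g: "g \<in> carrier G" for g
  proof -
    have "\<rho> g * ((1 / \<alpha> g (inv\<^bsub>G\<^esub> g)) \<cdot>\<^sub>m \<rho> (inv\<^bsub>G\<^esub> g))
        = (1 / \<alpha> g (inv\<^bsub>G\<^esub> g)) \<cdot>\<^sub>m (\<rho> g * \<rho> (inv\<^bsub>G\<^esub> g))"
      using \<rho>(1) g by (intro mult_smult_distrib) auto
    also have "\<dots> = 1\<^sub>m m"
      using mult[of g "inv\<^bsub>G\<^esub> g"] nz[of g "inv\<^bsub>G\<^esub> g"] g \<rho>(2) by (intro eq_matI) auto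
    finally show ?thesis .
  qed
  have inv: "invertible_mat (\<rho> g)" if g: "g \<in> carrier G" for g
  proof -
    let ?B = "(1 / \<alpha> g (inv\<^bsub>G\<^esub> g)) \<cdot>\<^sub>m \<rho> (inv\<^bsub>G\<^esub> g)"
    have B: "?B \<in> carrier_mat m m" using \<rho>(1) g by auto
    have "?B * \<rho> g = 1\<^sub>m m" using mat_mult_left_right_inverse[OF \<rho>(1)[OF g] B inverse[OF g]] .
    with inverse[OF g] show ?thesis
      using \<rho>(1)[OF g] B unfolding invertible_mat_def inverts_mat_def square_mat.simps
      by (intro conjI exI[of _ ?B]) auto
  qed
  have rep: "alpha_rep G \<alpha> m \<rho>" using \<rho> mult inv by (auto simp: alpha_rep_def)
  have "cocycle2 G \<alpha>"
    unfolding cocycle2_def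
  proof (intro conjI ballI)
    fix g h k assume ghk: "g \<in> carrier G" "h \<in> carrier G" "k \<in> carrier G"
    let ?M = "\<rho> (g \<otimes>\<^bsub>G\<^esub> (h \<otimes>\<^bsub>G\<^esub> k))"
    have M: "?M \<in> carrier_mat m m" using \<rho>(1) ghk by auto
    have "(\<alpha> g h * \<alpha> (g \<otimes>\<^bsub>G\<^esub> h) k) \<cdot>\<^sub>m ?M = \<alpha> g h \<cdot>\<^sub>m (\<rho> (g \<otimes>\<^bsub>G\<^esub> h) * \<rho> k)"
      using ghk mult[of "g \<otimes>\<^bsub>G\<^esub> h" k] by (auto simp: m_assoc)
    also have "\<dots> = (\<rho> g * \<rho> h) * \<rho> k"
      using ghk mult_smult_assoc_mat[OF \<rho>(1) \<rho>(1), of "g \<otimes>\<^bsub>G\<^esub> h" k] by (simp add: mult[of g h])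
    also have "\<dots> = \<rho> g * (\<rho> h * \<rho> k)"
      using ghk \<rho>(1) by (intro assoc_mult_mat) auto
    also have "\<dots> = \<alpha> h k \<cdot>\<^sub>m (\<rho> g * \<rho> (h \<otimes>\<^bsub>G\<^esub> k))"
      using ghk mult_smult_distrib[OF \<rho>(1) \<rho>(1), of g "h \<otimes>\<^bsub>G\<^esub> k"] by (simp add: mult[of h k])
    also have "\<dots> = (\<alpha> h k * \<alpha> g (h \<otimes>\<^bsub>G\<^esub> k)) \<cdot>\<^sub>m ?M"
      using ghk by (auto simp: mult)
    finally have eq: "(\<alpha> g h * \<alpha> (g \<otimes>\<^bsub>G\<^esub> h) k) \<cdot>\<^sub>m ?M = (\<alpha> h k * \<alpha> g (h \<otimes>\<^bsub>G\<^esub> k)) \<cdot>\<^sub>m ?M" .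
    \<comment> \<open>An invertible matrix of positive degree is not zero.\<close>
    have "?M \<noteq> 0\<^sub>m m m"
    proof
      assume 0: "?M = 0\<^sub>m m m"
      have x: "g \<otimes>\<^bsub>G\<^esub> (h \<otimes>\<^bsub>G\<^esub> k) \<in> carrier G" using ghk by simp
      have "0\<^sub>m m m * (z \<cdot>\<^sub>m \<rho> (inv\<^bsub>G\<^esub> (g \<otimes>\<^bsub>G\<^esub> (h \<otimes>\<^bsub>G\<^esub> k)))) = 0\<^sub>m m m" for z
        by (intro left_mult_zero_mat smult_carrier_mat \<rho>(1) inv_closed x)
      then have "1\<^sub>m m = (0\<^sub>m m m :: complex mat)" using inverse[OF x] unfolding 0 by simp
      then have "(1\<^sub>m m :: complex mat) $$ (0, 0) = 0\<^sub>m m m $$ (0, 0)" by simp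
      with m show False by simp
    qed
    then obtain i j where "i < m" "j < m" "?M $$ (i, j) \<noteq> 0" using M by (metis eq_matI carrier_matD index_zero_mat)
    with arg_cong[OF eq, of "\<lambda>M. M $$ (i, j)"] M
    show "\<alpha> g h * \<alpha> (g \<otimes>\<^bsub>G\<^esub> h) k = \<alpha> h k * \<alpha> g (h \<otimes>\<^bsub>G\<^esub> k)" by auto
  qed (use nz in auto)
  with rep faithful show ?thesis by (auto simp: faithful_proj_rep_def)
qed

section \<open>The groups \<open>elem_ab p n\<close> in coordinates\<close>

lemma group_elem_ab: "group (elem_ab p n)"
  by (simp add: elem_ab_def)

lemma carrier_elem_ab: "p > 0 \<Longrightarrow> carrier (elem_ab p n) = (\<Pi>\<^sub>E i\<in>{..<n}. {0..<int p})"
  by (simp add: elem_ab_def carrier_integer_mod_group)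

lemma one_elem_ab: "\<one>\<^bsub>elem_ab p n\<^esub> = (\<lambda>i\<in>{..<n}. 0)"
  by (simp add: elem_ab_def)

lemma mult_elem_ab: "g \<otimes>\<^bsub>elem_ab p n\<^esub> h = (\<lambda>i\<in>{..<n}. (g i + h i) mod int p)"
  by (simp add: elem_ab_def)

lemma card_elem_ab: "p > 0 \<Longrightarrow> card (carrier (elem_ab p n)) = p ^ n"
  by (simp add: carrier_elem_ab card_PiE)

lemma elem_ab_eq_oneI:
  assumes "p > 0" "g \<in> carrier (elem_ab p n)" "\<And>i. i < n \<Longrightarrow> g i = 0"
  shows "g = \<one>\<^bsub>elem_ab p n\<^esub>"
  using assms unfolding one_elem_ab carrier_elem_ab[OF assms(1)]
  by (intro extensionalityI[of _ "{..<n}"]) (auto simp: PiE_def)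

lemma pow_elem_ab:
  assumes "p > 0" "g \<in> carrier (elem_ab p n)"
  shows "g [^]\<^bsub>elem_ab p n\<^esub> p = \<one>\<^bsub>elem_ab p n\<^esub>"
proof -
  have "g [^]\<^bsub>elem_ab p n\<^esub> k = (\<lambda>i\<in>{..<n}. (int k * g i) mod int p)" for k
    by (induction k)
       (auto simp: nat_pow_def one_elem_ab mult_elem_ab algebra_simps mod_simps intro!: restrict_ext)
  then show ?thesis by (simp add: one_elem_ab)
qed

lemma root_of_unity_eq_1_iff:
  assumes "k < p"
  shows "cis (2 * pi / real p) ^ k = 1 \<longleftrightarrow> k = 0"
proof -
  have "inj_on (\<lambda>k. cis (2 * pi * real k / real p)) {..<p}"
    using bij_betw_roots_unity[of p] assms by (simp add: bij_betw_def)
  from inj_onD[OF this, of k 0] assms show ?thesis by (auto simp: DeMoivre mult_ac)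
qed

lemma faithful_proj_rep_elem_ab:
  assumes p: "p > 0"
  shows "\<exists>\<rho>. faithful_proj_rep (elem_ab p n) (n + 1) \<rho>"
proof -
  define \<zeta> where "\<zeta> = cis (2 * pi / real p)"
  have \<zeta>p: "\<zeta> ^ p = 1" using p by (simp add: \<zeta>_def DeMoivre)
  have \<zeta>_mod: "\<zeta> ^ (k mod p) = \<zeta> ^ k" for k
  proof -
    have "\<zeta> ^ k = \<zeta> ^ (k mod p + p * (k div p))" by simp
    also have "\<dots> = \<zeta> ^ (k mod p)" unfolding power_add power_mult \<zeta>p by simp
    finally show ?thesis by simp
  qed
  \<comment> \<open>Entry i < n is the i-th coordinate character; the extra entry at index n is the
    trivial character.\<close>
  define d where "d g i = (if i < n then \<zeta> ^ nat (g i) else 1)" for g :: "nat \<Rightarrow> int" and i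
  define \<rho> where "\<rho> g = mat (n + 1) (n + 1) (\<lambda>(i, j). if i = j then d g i else 0)" for g
  have car: "g i \<in> {0..<int p}" if "g \<in> carrier (elem_ab p n)" "i < n" for g i
    using that PiE_mem[of g "{..<n}" "\<lambda>_. {0..<int p}" i] by (simp add: carrier_elem_ab[OF p])
  have d_mult: "d g i * d h i = d (g \<otimes>\<^bsub>elem_ab p n\<^esub> h) i"
    if "g \<in> carrier (elem_ab p n)" "h \<in> carrier (elem_ab p n)" for g h i
  proof (cases "i < n")
    case True
    have "nat ((g i + h i) mod int p) = (nat (g i) + nat (h i)) mod p"
      using car[OF that(1) True] car[OF that(2) True] by (simp add: nat_mod_distrib nat_add_distrib)
    with True show ?thesis by (simp add: d_def mult_elem_ab \<zeta>_mod power_add)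
  qed (simp add: d_def)
  have "faithful_proj_rep (elem_ab p n) (n + 1) \<rho>"
  proof (rule faithful_proj_repI[where \<alpha> = "\<lambda>_ _. 1"])
    show "\<rho> \<one>\<^bsub>elem_ab p n\<^esub> = 1\<^sub>m (n + 1)"
      by (intro eq_matI) (auto simp: \<rho>_def d_def one_elem_ab)
  next
    fix g h assume gh: "g \<in> carrier (elem_ab p n)" "h \<in> carrier (elem_ab p n)"
    show "\<rho> g * \<rho> h = 1 \<cdot>\<^sub>m \<rho> (g \<otimes>\<^bsub>elem_ab p n\<^esub> h)"
    proof (rule eq_matI)
      fix i j assume "i < dim_row (1 \<cdot>\<^sub>m \<rho> (g \<otimes>\<^bsub>elem_ab p n\<^esub> h))"
        "j < dim_col (1 \<cdot>\<^sub>m \<rho> (g \<otimes>\<^bsub>elem_ab p n\<^esub> h))"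
      then have ij: "i < n + 1" "j < n + 1" by (auto simp: \<rho>_def)
      have "(\<rho> g * \<rho> h) $$ (i, j)
          = (\<Sum>l<n + 1. (if i = l then d g i else 0) * (if l = j then d h l else 0))"
        using ij by (simp add: \<rho>_def scalar_prod_def lessThan_atLeast0)
      also have "\<dots> = (\<Sum>l<n + 1. if l = i then d g i * (if i = j then d h i else 0) else 0)"
        by (intro sum.cong) auto
      also have "\<dots> = (if i = j then d g i * d h i else 0)"
        using ij by (subst sum.delta) auto
      finally show "(\<rho> g * \<rho> h) $$ (i, j) = (1 \<cdot>\<^sub>m \<rho> (g \<otimes>\<^bsub>elem_ab p n\<^esub> h)) $$ (i, j)"
        using ij d_mult[OF gh] by (simp add: \<rho>_def)
    qed (auto simp: \<rho>_def)
  next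
    fix g c assume g: "g \<in> carrier (elem_ab p n)" and scalar: "\<rho> g = c \<cdot>\<^sub>m 1\<^sub>m (n + 1)"
    have diag: "d g i = c" if "i < n + 1" for i
      using arg_cong[OF scalar, of "\<lambda>M. M $$ (i, i)"] that by (simp add: \<rho>_def)
    have "g i = 0" if i: "i < n" for i
    proof -
      \<comment> \<open>The trivial character at index n forces c = 1.\<close>
      have "\<zeta> ^ nat (g i) = 1" using diag[of i] diag[of n] i by (simp add: d_def)
      moreover have "nat (g i) < p" "0 \<le> g i" using car[OF g i] by auto
      ultimately show ?thesis using root_of_unity_eq_1_iff[of "nat (g i)" p] by (simp add: \<zeta>_def)
    qed
    then show "g = \<one>\<^bsub>elem_ab p n\<^esub>" using g p by (intro elem_ab_eq_oneI)
  qed (auto simp: \<rho>_def group_elem_ab)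
  then show ?thesis by blast
qed

section \<open>Pauli matrices and the two exceptional groups\<close>

text \<open>Entry \<open>(i, j)\<close> of \<open>Z\<^sup>y X\<^sup>x\<close>, where \<open>X\<close> swaps the basis vectors and \<open>Z = diag(1, -1)\<close>.\<close>

definition pauli :: "int \<Rightarrow> int \<Rightarrow> nat \<Rightarrow> nat \<Rightarrow> complex" where
  "pauli x y i j = (if even (x + int i + int j) then (-1) ^ (nat y * i) else 0)"

text \<open>Moving X^x past Z^y' costs the sign (-1)^(x y'); the exponents then add modulo
  2.\<close>

lemma pauli_mult:
  assumes "x \<in> {0, 1}" "y \<in> {0, 1}" "x' \<in> {0, 1}" "y' \<in> {0, 1}" "i \<in> {0, 1}" "j \<in> {0, 1}"
  shows "pauli x y i 0 * pauli x' y' 0 j + pauli x y i 1 * pauli x' y' 1 j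
    = (-1) ^ nat (x * y') * pauli ((x + x') mod 2) ((y + y') mod 2) i j"
  using assms by (auto simp: pauli_def)

lemma elem_ab_2_cases:
  assumes "g \<in> carrier (elem_ab 2 n)" "i < n"
  shows "g i \<in> {0, 1}"
proof -
  have "g i \<in> {0..<2}"
    using assms PiE_mem[of g "{..<n}" "\<lambda>_. {0..<2}" i] by (simp add: carrier_elem_ab)
  then show ?thesis by auto
qed

lemma faithful_proj_rep_elem_ab_2_2: "\<exists>\<rho>. faithful_proj_rep (elem_ab 2 2) 2 \<rho>"
proof -
  define \<rho> where "\<rho> g = mat 2 2 (\<lambda>(i, j). pauli (g 0) (g 1) i j)" for g :: "nat \<Rightarrow> int"
  have "faithful_proj_rep (elem_ab 2 2) 2 \<rho>"
  proof (rule faithful_proj_repI[where \<alpha> = "\<lambda>g h. (-1) ^ nat (g 0 * h 1)"])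
    show "\<rho> \<one>\<^bsub>elem_ab 2 2\<^esub> = 1\<^sub>m 2"
      by (intro eq_matI) (auto simp: \<rho>_def one_elem_ab pauli_def less_2_cases_iff)
  next
    fix g h assume gh: "g \<in> carrier (elem_ab 2 2)" "h \<in> carrier (elem_ab 2 2)"
    have "g 0 \<in> {0, 1}" "g 1 \<in> {0, 1}" "h 0 \<in> {0, 1}" "h 1 \<in> {0, 1}"
      using gh elem_ab_2_cases[of _ 2] by auto
    note mult = pauli_mult[OF this]
    show "\<rho> g * \<rho> h = (-1) ^ nat (g 0 * h 1) \<cdot>\<^sub>m \<rho> (g \<otimes>\<^bsub>elem_ab 2 2\<^esub> h)" (is "?L = ?R")
    proof (rule eq_matI)
      fix i j assume "i < dim_row ?R" "j < dim_col ?R"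
      then have ij: "i < 2" "j < 2" by (auto simp: \<rho>_def)
      have "?L $$ (i, j) = (\<Sum>l<2. pauli (g 0) (g 1) i l * pauli (h 0) (h 1) l j)"
        using ij by (simp add: \<rho>_def scalar_prod_def lessThan_atLeast0)
      also have "\<dots> = ?R $$ (i, j)"
        using mult[of i j] ij by (auto simp: \<rho>_def mult_elem_ab numeral_2_eq_2 less_Suc_eq)
      finally show "?L $$ (i, j) = ?R $$ (i, j)" .
    qed (auto simp: \<rho>_def)
  next
    fix g c assume g: "g \<in> carrier (elem_ab 2 2)" and scalar: "\<rho> g = c \<cdot>\<^sub>m 1\<^sub>m 2"
    have entry: "pauli (g 0) (g 1) i j = (if i = j then c else 0)" if "i < 2" "j < 2" for i j
      using arg_cong[OF scalar, of "\<lambda>M. M $$ (i, j)"] that by (simp add: \<rho>_def)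
    have "g 0 \<in> {0, 1}" "g 1 \<in> {0, 1}" using g elem_ab_2_cases[of _ 2] by auto
    \<comment> \<open>The zero entry (0, 1) excludes the factor X, and the equal diagonal entries
      then exclude Z.\<close>
    then have "g 0 = 0 \<and> g 1 = 0"
      using entry[of 0 0] entry[of 0 1] entry[of 1 1] by (auto simp: pauli_def)
    then show "g = \<one>\<^bsub>elem_ab 2 2\<^esub>"
      using g by (intro elem_ab_eq_oneI) (auto simp: less_2_cases_iff)
  qed (auto simp: \<rho>_def group_elem_ab)
  then show ?thesis by blast
qed

lemma faithful_proj_rep_elem_ab_2_4: "\<exists>\<rho>. faithful_proj_rep (elem_ab 2 4) 4 \<rho>"
proof -
  \<comment> \<open>Kronecker product: i mod 2 and i div 2 index the two tensor factors.\<close>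
  define e where "e g i j = pauli (g 0) (g 1) (i mod 2) (j mod 2) * pauli (g 2) (g 3) (i div 2) (j div 2)"
    for g :: "nat \<Rightarrow> int" and i j
  define \<rho> where "\<rho> g = mat 4 4 (\<lambda>(i, j). e g i j)" for g
  define \<alpha> where "\<alpha> g h = (-1) ^ nat (g 0 * h 1) * (-1 :: complex) ^ nat (g 2 * h 3)"
    for g h :: "nat \<Rightarrow> int"
  have less_4: "i = 0 \<or> i = 1 \<or> i = 2 \<or> i = 3" if "i < 4" for i :: nat using that by auto
  have "faithful_proj_rep (elem_ab 2 4) 4 \<rho>"
  proof (rule faithful_proj_repI[where \<alpha> = \<alpha>])
    show "\<rho> \<one>\<^bsub>elem_ab 2 4\<^esub> = 1\<^sub>m 4"
      by (intro eq_matI) (auto simp: \<rho>_def e_def one_elem_ab pauli_def dest!: less_4)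
  next
    fix g h assume gh: "g \<in> carrier (elem_ab 2 4)" "h \<in> carrier (elem_ab 2 4)"
    have bits: "g l \<in> {0, 1}" "h l \<in> {0, 1}" if "l < 4" for l
      using gh that elem_ab_2_cases[of _ 4] by auto
    have mult: "pauli (g k) (g l) i 0 * pauli (h k) (h l) 0 j + pauli (g k) (g l) i 1 * pauli (h k) (h l) 1 j
      = (-1) ^ nat (g k * h l) * pauli ((g k + h k) mod 2) ((g l + h l) mod 2) i j"
      if "k < 4" "l < 4" "i < 2" "j < 2" for k l i j
      using that by (intro pauli_mult bits) auto
    show "\<rho> g * \<rho> h = \<alpha> g h \<cdot>\<^sub>m \<rho> (g \<otimes>\<^bsub>elem_ab 2 4\<^esub> h)" (is "?L = ?R")
    proof (rule eq_matI)
      fix i j assume "i < dim_row ?R" "j < dim_col ?R"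
      then have ij: "i < 4" "j < 4" by (auto simp: \<rho>_def)
      have "{0..<4} = {0, 1, 2, 3 :: nat}" by auto
      then have "?L $$ (i, j) = e g i 0 * e h 0 j + e g i 1 * e h 1 j + e g i 2 * e h 2 j + e g i 3 * e h 3 j"
        using ij by (simp add: \<rho>_def scalar_prod_def)
      \<comment> \<open>The sum over four indices factors into one sum over each binary digit, to
        which \<open>pauli_mult\<close> applies.\<close>
      also have "\<dots> =
          (pauli (g 0) (g 1) (i mod 2) 0 * pauli (h 0) (h 1) 0 (j mod 2) +
           pauli (g 0) (g 1) (i mod 2) 1 * pauli (h 0) (h 1) 1 (j mod 2)) *
          (pauli (g 2) (g 3) (i div 2) 0 * pauli (h 2) (h 3) 0 (j div 2) +
           pauli (g 2) (g 3) (i div 2) 1 * pauli (h 2) (h 3) 1 (j div 2))"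
        by (simp add: e_def algebra_simps)
      also have "\<dots> = \<alpha> g h * e (g \<otimes>\<^bsub>elem_ab 2 4\<^esub> h) i j"
        using ij by (subst (1 2) mult) (auto simp: e_def \<alpha>_def mult_elem_ab)
      finally show "?L $$ (i, j) = ?R $$ (i, j)" using ij by (simp add: \<rho>_def)
    qed (auto simp: \<rho>_def)
  next
    fix g c assume g: "g \<in> carrier (elem_ab 2 4)" and scalar: "\<rho> g = c \<cdot>\<^sub>m 1\<^sub>m 4"
    have entry: "e g i j = (if i = j then c else 0)" if "i < 4" "j < 4" for i j
      using arg_cong[OF scalar, of "\<lambda>M. M $$ (i, j)"] that by (simp add: \<rho>_def)
    have "g 0 \<in> {0, 1}" "g 1 \<in> {0, 1}" "g 2 \<in> {0, 1}" "g 3 \<in> {0, 1}"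
      using g elem_ab_2_cases[of _ 4] by auto
    \<comment> \<open>The entries (0, 1), (0, 2), (0, 3) exclude X in either factor; then the
      diagonal entries at 1 and 2 exclude Z in the first and second factor.\<close>
    then have "g 0 = 0 \<and> g 1 = 0 \<and> g 2 = 0 \<and> g 3 = 0"
      using entry[of 0 0] entry[of 0 1] entry[of 0 2] entry[of 0 3] entry[of 1 1] entry[of 2 2]
      by (auto simp: e_def pauli_def)
    then show "g = \<one>\<^bsub>elem_ab 2 4\<^esub>"
      using g by (intro elem_ab_eq_oneI) (auto dest!: less_4)
  qed (auto simp: \<rho>_def \<alpha>_def group_elem_ab)
  then show ?thesis by blast
qed

subsection \<open>The minimal degree\<close>

lemma elementary_abelian_group_of_iso:
  assumes "group G" "prime p" and iso: "G \<cong> elem_ab p n"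
  shows "elementary_abelian_group G p n"
proof -
  interpret G: group G by fact
  interpret E: group "elem_ab p n" by (rule group_elem_ab)
  obtain f where f: "f \<in> iso G (elem_ab p n)" using iso by (auto simp: is_iso_def)
  interpret f: group_hom G "elem_ab p n" f using f by unfold_locales (auto simp: iso_def)
  have inj: "inj_on f (carrier G)" using f by (auto simp: iso_def bij_betw_def)
  have p: "p > 0" using \<open>prime p\<close> by (rule prime_gt_0_nat)
  show ?thesis
  proof
    show "x \<otimes>\<^bsub>G\<^esub> y = y \<otimes>\<^bsub>G\<^esub> x" if "x \<in> carrier G" "y \<in> carrier G" for x y
      using that by (intro inj_onD[OF inj]) (simp_all add: mult_elem_ab add.commute)
    show "card (carrier G) = p ^ n" using iso_same_card[OF iso] card_elem_ab[OF p] by simp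
    show "x [^]\<^bsub>G\<^esub> p = \<one>\<^bsub>G\<^esub>" if x: "x \<in> carrier G" for x
    proof (rule inj_onD[OF inj])
      show "f (x [^]\<^bsub>G\<^esub> p) = f \<one>\<^bsub>G\<^esub>"
        using x p by (simp add: f.hom_nat_pow pow_elem_ab)
    qed (use x in simp_all)
  qed fact
qed

text \<open>2 k + 1 \<le> p^k fails only for p = 2 with k = 1 or k = 2, where p^k = 2 k.\<close>

lemma degree_arith:
  fixes c k m n p :: nat
  assumes "prime p" and c: "c \<ge> 1" and n: "n + 1 \<le> 2 * k + c" and m: "c * p ^ k \<le> m"
  shows "n \<le> m" "p \<noteq> 2 \<or> n \<notin> {2, 4} \<Longrightarrow> n + 1 \<le> m"
proof -
  have big: "n + 1 \<le> m" if "2 * k + 1 \<le> p ^ k"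
  proof -
    have "2 * k + c \<le> c * (2 * k + 1)" using c by (cases c) auto
    also have "\<dots> \<le> m" using mult_le_mono2[OF that, of c] m by simp
    finally show ?thesis using n by simp
  qed
  have p: "p \<ge> 2" using \<open>prime p\<close> by (rule prime_ge_2_nat)
  have "2 * k + 1 \<le> p ^ k" if "p \<ge> 3"
  proof -
    have "2 * k + 1 \<le> 3 ^ k" by (induction k) auto
    also have "\<dots> \<le> p ^ k" using that by (rule power_mono) simp
    finally show ?thesis .
  qed
  moreover have "2 * k + 1 \<le> p ^ k" if "k \<ge> 3"
  proof -
    have "2 * k + 1 \<le> 2 ^ k" using that by (induction k rule: dec_induct) auto
    also have "\<dots> \<le> p ^ k" using p by (rule power_mono) simp
    finally show ?thesis .
  qed
  moreover have "2 * k + 1 \<le> p ^ k" if "k = 0" using that by simp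
  ultimately have "n + 1 \<le> m \<or> p = 2 \<and> (k = 1 \<or> k = 2)" using big p by linarith
  \<comment> \<open>In the remaining case m \<ge> 2 k c. For c \<ge> 2 this is at least 2 k + c; for
    c = 1 it gives m \<ge> 2 k \<ge> n, and m > n unless n = 2 k, which is 2 or 4.\<close>
  then show "n \<le> m" "p \<noteq> 2 \<or> n \<notin> {2, 4} \<Longrightarrow> n + 1 \<le> m" using c n m by auto
qed

lemma faithful_degree_bounds:
  assumes "group G" "prime p" "n \<ge> 1" "G \<cong> elem_ab p n" and rep: "faithful_proj_rep G m \<rho>"
  shows "n \<le> m" "p \<noteq> 2 \<or> n \<notin> {2, 4} \<Longrightarrow> n + 1 \<le> m"
proof -
  interpret elementary_abelian_group G p n
    by (rule elementary_abelian_group_of_iso[OF assms(1,2,4)])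
  obtain \<alpha> where \<alpha>: "cocycle2 G \<alpha>" "alpha_rep G \<alpha> m \<rho>"
    and faithful: "\<And>g c. g \<in> carrier G \<Longrightarrow> \<rho> g = c \<cdot>\<^sub>m 1\<^sub>m m \<Longrightarrow> g = \<one>\<^bsub>G\<^esub>"
    using rep unfolding faithful_proj_rep_def by blast
  have "m > 0"
  proof (rule ccontr)
    \<comment> \<open>In degree 0 every matrix is scalar, so faithfulness would make G trivial,
      against n \<ge> 1.\<close>
    assume "\<not> m > 0"
    then have "\<rho> g = 1 \<cdot>\<^sub>m 1\<^sub>m m" if "g \<in> carrier G" for g
      using \<alpha>(2) that by (intro eq_matI) (auto simp: alpha_rep_def)
    then have "carrier G = {\<one>\<^bsub>G\<^esub>}" using faithful by blast
    then have "p ^ n = 1" using card_carrier by simp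
    then show False using prime_gt_1_nat[OF \<open>prime p\<close>] \<open>n \<ge> 1\<close> by simp
  qed
  interpret elementary_abelian_rep G p n \<alpha> m \<rho>
    using \<alpha> \<open>m > 0\<close> by unfold_locales
  obtain k c where "c \<ge> 1" "n + 1 \<le> 2 * k + c" "c * p ^ k \<le> m"
    using degree_lower_bound[OF faithful] .
  from degree_arith[OF \<open>prime p\<close> this]
  show "n \<le> m" "p \<noteq> 2 \<or> n \<notin> {2, 4} \<Longrightarrow> n + 1 \<le> m" .
qed

theorem theorem4p9:
  fixes G :: "('g, 'b) monoid_scheme" and p n :: nat
  assumes "group G" and "prime p" and "n \<ge> 1" and "G \<cong> elem_ab p n"
  shows "(\<not> G \<cong> elem_ab 2 2 \<and> \<not> G \<cong> elem_ab 2 4 \<longrightarrow> tau G = n + 1) \<and>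
         (G \<cong> elem_ab 2 2 \<or> G \<cong> elem_ab 2 4 \<longrightarrow> tau G = n)"
proof (intro conjI impI)
  note bounds = faithful_degree_bounds[OF assms]
  have transfer: "\<exists>\<rho>. faithful_proj_rep G m \<rho>"
    if "G \<cong> elem_ab q l" and "\<exists>\<rho>. faithful_proj_rep (elem_ab q l) m \<rho>" for q l m
    using that faithful_proj_rep_iso[OF \<open>group G\<close> group_elem_ab] unfolding is_iso_def by blast
  {
    assume "\<not> G \<cong> elem_ab 2 2 \<and> \<not> G \<cong> elem_ab 2 4"
    then have "p \<noteq> 2 \<or> n \<notin> {2, 4}" using assms(4) by auto
    moreover have "\<exists>\<rho>. faithful_proj_rep G (n + 1) \<rho>"
      using transfer[OF assms(4)] faithful_proj_rep_elem_ab prime_gt_0_nat[OF assms(2)] by blast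
    ultimately show "tau G = n + 1"
      unfolding tau_def using bounds(2) by (intro Least_equality) auto
  next
    assume exceptional: "G \<cong> elem_ab 2 2 \<or> G \<cong> elem_ab 2 4"
    \<comment> \<open>Comparing orders gives p^n = 2^l, and a prime power determines its
      exponent.\<close>
    have n_eq: "n = l" if "G \<cong> elem_ab 2 l" "l > 0" for l
    proof -
      have "p ^ n = 2 ^ l"
        using iso_same_card[OF assms(4)] iso_same_card[OF that(1)] card_elem_ab[of p n]
          card_elem_ab[of 2 l] prime_gt_0_nat[OF assms(2)] by simp
      then show ?thesis
        by (rule prime_power_inj'(2)[OF assms(2) two_is_prime_nat]) (use assms(3) that(2) in auto)
    qed
    have "\<exists>\<rho>. faithful_proj_rep G n \<rho>"
      using exceptional
    proof
      assume "G \<cong> elem_ab 2 2"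
      then show ?thesis using transfer n_eq[of 2] faithful_proj_rep_elem_ab_2_2 by auto
    next
      assume "G \<cong> elem_ab 2 4"
      then show ?thesis using transfer n_eq[of 4] faithful_proj_rep_elem_ab_2_4 by auto
    qed
    then show "tau G = n" unfolding tau_def using bounds(1) by (intro Least_equality) auto
  }
qed

end
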